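(* Let $\Gamma$ be a finitely generated group and let $S\subseteq\Gamma$ be a finite symmetric generating set with $e\in S$. Suppose that $\Gamma$ contains an infinite amenable subgroup $\Lambda$ such that $\Lambda\cap s^{-1}\Lambda s$ is infinite for every $s\in S$. Then $\Gamma$ has fixed price one.
   Context: Symmetric means $S=S^{-1}$; $e$ is the identity. Cost. Let $(X,\mu)$ be a standard probability space and $\mathcal R$ a countable probability-measure-preserving (pmp) equivalence relation on $X$. A graphing of $\mathcal R$ is a countable family $\Phi=\{\varphi_i:A_i\to B_i\}_{i\in I}$ of measure-preserving Borel isomorphisms between Borel subsets of $X$ with $(x,\varphi_i(x))\in\mathcal R$ for all $i\in I$, $x\in A_i$. It defines a graph on $X$ by joining $x$ to $\varphi_i(x)$; $\Phi$ generates $\mathcal R$ if, on a conull subset of $X$, the connected components of this graph are precisely the $\mathcal R$-classes. Put $\operatorname{cost}(\Phi)=\sum_{i}\mu(A_i)$ and $\operatorname{cost}(\mathcal R)=\inf\{\operatorname{cost}(\Phi):\Phi \text{ is a graphing that generates }\mathcal R\}$. For an essentially free pmp action $\Gamma\curvearrowright(X,\mu)$ of a countable group, $\operatorname{cost}(\Gamma\curvearrowright X)$ is the cost of its orbit equivalence relation. A countable group has fixed price one if every essentially free pmp action of it (on a standard probability space) has cost $1$. *)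

theory Defs
  imports "HOL-Probability.Probability" "HOL-Algebra.Group_Action" "HOL-Algebra.Generated_Groups"
begin

definition amenable_group :: "('g, 'm) monoid_scheme \<Rightarrow> bool" where
  "amenable_group G \<longleftrightarrow> group G \<and>
     (\<exists>m :: 'g set \<Rightarrow> real.
        (\<forall>A. A \<subseteq> carrier G \<longrightarrow> 0 \<le> m A) \<and>
        m (carrier G) = 1 \<and>
        (\<forall>A B. A \<subseteq> carrier G \<longrightarrow> B \<subseteq> carrier G \<longrightarrow> A \<inter> B = {} \<longrightarrow> m (A \<union> B) = m A + m B) \<and>
        (\<forall>g\<in>carrier G. \<forall>A. A \<subseteq> carrier G \<longrightarrow> m (g <#\<^bsub>G\<^esub> A) = m A))"

text \<open>A standard probability space is a Borel probability measure on a standard Borel space.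
  The Polish topology lives on \<^term>\<open>space M\<close>, so it need not be an instance of the class
  \<^class>\<open>polish_space\<close> on the whole type. Atoms are allowed.\<close>

definition standard_prob_space :: "'x measure \<Rightarrow> bool" where
  "standard_prob_space M \<longleftrightarrow> prob_space M \<and>
     (\<exists>T. topspace T = space M \<and> completely_metrizable_space T \<and> second_countable T \<and>
          sets M = sigma_sets (space M) {U. openin T U})"

definition mp_borel_iso :: "'x measure \<Rightarrow> 'x set \<Rightarrow> 'x set \<Rightarrow> ('x \<Rightarrow> 'x) \<Rightarrow> bool" where
  "mp_borel_iso M A B f \<longleftrightarrow> A \<in> sets M \<and> B \<in> sets M \<and> bij_betw f A B \<and>
     f \<in> measurable (restrict_space M A) (restrict_space M B) \<and>
     the_inv_into A f \<in> measurable (restrict_space M B) (restrict_space M A) \<and>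
     distr (restrict_space M A) (restrict_space M B) f = restrict_space M B"

text \<open>A countable family of partial isomorphisms \<open>\<phi> i : A i \<rightarrow> B i\<close> is indexed by a set
  \<open>I\<close> of natural numbers; values at indices outside \<open>I\<close> and of \<open>\<phi> i\<close> outside \<open>A i\<close>
  play no role.\<close>

definition graphing ::
  "'x measure \<Rightarrow> ('x \<times> 'x) set \<Rightarrow> nat set \<Rightarrow> (nat \<Rightarrow> 'x set) \<Rightarrow> (nat \<Rightarrow> 'x set) \<Rightarrow> (nat \<Rightarrow> 'x \<Rightarrow> 'x) \<Rightarrow> bool"
  where
  "graphing M R I A B \<phi> \<longleftrightarrow>
     (\<forall>i\<in>I. mp_borel_iso M (A i) (B i) (\<phi> i) \<and> (\<forall>x\<in>A i. (x, \<phi> i x) \<in> R))"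

definition graphing_edges :: "nat set \<Rightarrow> (nat \<Rightarrow> 'x set) \<Rightarrow> (nat \<Rightarrow> 'x \<Rightarrow> 'x) \<Rightarrow> ('x \<times> 'x) set" where
  "graphing_edges I A \<phi> = {(x, \<phi> i x) | i x. i \<in> I \<and> x \<in> A i}"

definition graphing_component ::
  "nat set \<Rightarrow> (nat \<Rightarrow> 'x set) \<Rightarrow> (nat \<Rightarrow> 'x \<Rightarrow> 'x) \<Rightarrow> 'x \<Rightarrow> 'x set" where
  "graphing_component I A \<phi> x = (graphing_edges I A \<phi> \<union> (graphing_edges I A \<phi>)\<inverse>)\<^sup>* `` {x}"

definition generates ::
  "'x measure \<Rightarrow> ('x \<times> 'x) set \<Rightarrow> nat set \<Rightarrow> (nat \<Rightarrow> 'x set) \<Rightarrow> (nat \<Rightarrow> 'x \<Rightarrow> 'x) \<Rightarrow> bool" where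
  "generates M R I A \<phi> \<longleftrightarrow> (AE x in M. graphing_component I A \<phi> x = R `` {x})"

text \<open>In \<^typ>\<open>ennreal\<close> every family is summable and every set has an infimum, so both
  quantities below are meaningful without side conditions.\<close>

definition graphing_cost :: "'x measure \<Rightarrow> nat set \<Rightarrow> (nat \<Rightarrow> 'x set) \<Rightarrow> ennreal" where
  "graphing_cost M I A = (\<Sum>\<^sub>\<infinity>i\<in>I. emeasure M (A i))"

definition cost :: "'x measure \<Rightarrow> ('x \<times> 'x) set \<Rightarrow> ennreal" where
  "cost M R = Inf {graphing_cost M I A | I A B \<phi>. graphing M R I A B \<phi> \<and> generates M R I A \<phi>}"

definition pmp_action :: "('g, 'm) monoid_scheme \<Rightarrow> 'x measure \<Rightarrow> ('g \<Rightarrow> 'x \<Rightarrow> 'x) \<Rightarrow> bool" where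
  "pmp_action G M \<alpha> \<longleftrightarrow> group_action G (space M) \<alpha> \<and>
     (\<forall>g\<in>carrier G. \<alpha> g \<in> measurable M M \<and> distr M M (\<alpha> g) = M)"

definition essentially_free :: "('g, 'm) monoid_scheme \<Rightarrow> 'x measure \<Rightarrow> ('g \<Rightarrow> 'x \<Rightarrow> 'x) \<Rightarrow> bool" where
  "essentially_free G M \<alpha> \<longleftrightarrow>
     (AE x in M. \<forall>g\<in>carrier G. \<alpha> g x = x \<longrightarrow> g = \<one>\<^bsub>G\<^esub>)"

definition orbit_relation :: "('g, 'm) monoid_scheme \<Rightarrow> 'x measure \<Rightarrow> ('g \<Rightarrow> 'x \<Rightarrow> 'x) \<Rightarrow> ('x \<times> 'x) set" where
  "orbit_relation G M \<alpha> = {(x, \<alpha> g x) | x g. x \<in> space M \<and> g \<in> carrier G}"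

text \<open>Intended for countable groups. The type argument is the type in which the points of the
  probability spaces live. A quantifier over types is not available inside a definition, so a
  theorem asserting fixed price one should leave \<open>'x\<close> arbitrary.\<close>

definition fixed_price_one :: "'x itself \<Rightarrow> ('g, 'm) monoid_scheme \<Rightarrow> bool" where
  "fixed_price_one TYPE('x) G \<longleftrightarrow>
     (\<forall>(M :: 'x measure) \<alpha>.
        standard_prob_space M \<longrightarrow> pmp_action G M \<alpha> \<longrightarrow> essentially_free G M \<alpha> \<longrightarrow>
        cost M (orbit_relation G M \<alpha>) = 1)"

end

theory Submission
  imports Defs
begin

text \<open>
The inequality \<open>cost \<ge> 1\<close> holds because almost all orbits are infinite: there are measurable sets
\<open>C\<close> of arbitrarily small measure that meet almost every orbit. In a graph that connects
almost every point to \<open>C\<close>, each point outside \<open>C\<close> has an edge leading one step closer to \<open>C\<close>, and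
no edge is used by two points. So a generating graphing has cost at least \<open>1 - \<mu> C\<close>
(\<open>emeasure_connected_to_le\<close>, \<open>cost_ge_one\<close>).

For \<open>cost \<le> 1 + \<epsilon>\<close> it suffices to generate the orbits of \<open>\<Lambda>\<close> at cost barely more than one. A
generator \<open>s\<close> can then be restricted to a set of tiny measure that meets almost every orbit of
the infinite group \<open>\<Lambda> \<inter> s\<^sup>-\<^sup>1 \<Lambda> s\<close>: from any point, first move into this set inside \<open>\<Lambda>\<close>, apply
\<open>s\<close>, and correct the result by the conjugated element, which again lies in \<open>\<Lambda>\<close>
(\<open>cheap_generation\<close>).

That orbits of \<open>\<Lambda>\<close> are cheap is a quantitative form of hyperfiniteness. An invariant mean yields
Folner sets: otherwise Hall's marriage theorem would produce a paradoxical decomposition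
(\<open>folner_set\<close>). Given a Folner set \<open>F\<close>, a greedy procedure partitions almost all of the space
into finite clusters of the form \<open>F x \<inter> Y\<close>, where \<open>Y\<close> is what is left when the cluster is chosen. The
point is that for any \<open>Y\<close> of positive measure, averaging over \<open>x\<close> finds clusters \<open>F x \<inter> Y\<close>
with a small boundary inside \<open>Y\<close>, although \<open>Y\<close> itself need not be invariant in any sense
(\<open>greedy_clusters\<close>). Joining each point to the centre of its cluster costs at most the measure of the
space, and the edges between different clusters are rare (\<open>amenable_cheap_links\<close>).

This realises finitely many elements of \<open>\<Lambda>\<close> at cost \<open>1 + \<epsilon>\<close>. The remaining elements are treated
in the same way inside sections of rapidly decreasing measure, and add an arbitrarily small amount
(\<open>amenable_cheap_generation\<close>).
\<close>

section \<open>Hall's theorem for locally finite families\<close>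

definition hall_condition :: "'i set \<Rightarrow> ('i \<Rightarrow> 'v set) \<Rightarrow> bool" where
  "hall_condition I S \<longleftrightarrow> (\<forall>J. finite J \<longrightarrow> J \<subseteq> I \<longrightarrow> card J \<le> card (\<Union>i\<in>J. S i))"

lemma hall_conditionD:
  "hall_condition I S \<Longrightarrow> finite J \<Longrightarrow> J \<subseteq> I \<Longrightarrow> card J \<le> card (\<Union>i\<in>J. S i)"
  by (auto simp: hall_condition_def)

text \<open>If deleting \<open>x\<close> from the set offered to \<open>i\<close> destroys Hall's condition, then the obstruction involves
\<open>i\<close>; splitting \<open>i\<close> off leaves a set \<open>J\<close> of other indices, and this is the form in which two
obstructions can be added up.\<close>

lemma hall_remove_violates:
  assumes hall: "hall_condition I S" and viol: "\<not> hall_condition I (S(i := S i - {x}))"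
  obtains J where "finite J" "J \<subseteq> I" "i \<notin> J" "card ((\<Union>j\<in>J. S j) \<union> (S i - {x})) \<le> card J"
proof -
  let ?T = "S(i := S i - {x})"
  obtain J where J: "finite J" "J \<subseteq> I" and lt: "card (\<Union>j\<in>J. ?T j) < card J"
    using viol by (auto simp: hall_condition_def not_le)
  have iJ: "i \<in> J"
  proof (rule ccontr)
    assume "i \<notin> J"
    then have "(\<Union>j\<in>J. ?T j) = (\<Union>j\<in>J. S j)" by (auto split: if_splits)
    with lt hall_conditionD[OF hall J] show False by simp
  qed
  have "(\<Union>j\<in>J. ?T j) = (\<Union>j\<in>J - {i}. S j) \<union> (S i - {x})"
    using iJ by (auto split: if_splits)
  with lt iJ J have "card ((\<Union>j\<in>J - {i}. S j) \<union> (S i - {x})) \<le> card (J - {i})"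
    by simp
  with J show ?thesis by (intro that[of "J - {i}"]) auto
qed

text \<open>Rado's argument. If neither of two points \<open>x\<close>, \<open>y\<close> could be deleted from \<open>S i\<close>, the two
obstructions \<open>J\<close> and \<open>L\<close> would together offer at most \<open>card J + card L\<close> points, counted with
multiplicity. But Hall's condition for \<open>insert i (J \<union> L)\<close> and for \<open>J \<inter> L\<close> demands one more, the
deleted points being restored in the union because \<open>x \<noteq> y\<close>.\<close>

lemma hall_minimal_singleton:
  assumes fin: "\<And>i. i \<in> I \<Longrightarrow> finite (S i)" and hall: "hall_condition I S" and i: "i \<in> I"
    and min: "\<And>x. x \<in> S i \<Longrightarrow> \<not> hall_condition I (S(i := S i - {x}))"
    and x: "x \<in> S i" and y: "y \<in> S i"
  shows "x = y"
proof (rule ccontr)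
  assume "x \<noteq> y"
  obtain J where J: "finite J" "J \<subseteq> I" "i \<notin> J"
      and cJ: "card ((\<Union>j\<in>J. S j) \<union> (S i - {x})) \<le> card J"
    using hall_remove_violates[OF hall min[OF x]] by metis
  obtain L where L: "finite L" "L \<subseteq> I" "i \<notin> L"
      and cL: "card ((\<Union>j\<in>L. S j) \<union> (S i - {y})) \<le> card L"
    using hall_remove_violates[OF hall min[OF y]] by metis
  let ?P = "(\<Union>j\<in>J. S j) \<union> (S i - {x})" and ?Q = "(\<Union>j\<in>L. S j) \<union> (S i - {y})"
  have finP: "finite ?P" "finite ?Q"
    using J L i by (auto intro!: fin)
  have un: "?P \<union> ?Q = (\<Union>j\<in>insert i (J \<union> L). S j)"
    using \<open>x \<noteq> y\<close> by auto
  have "card J + card L + 1 = card (insert i (J \<union> L)) + card (J \<inter> L)"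
    using J L card_Un_Int[OF J(1) L(1)] by simp
  moreover have "card (insert i (J \<union> L)) \<le> card (?P \<union> ?Q)"
    unfolding un using J L i by (intro hall_conditionD[OF hall]) auto
  moreover have "card (J \<inter> L) \<le> card (\<Union>j\<in>J \<inter> L. S j)"
    using J by (intro hall_conditionD[OF hall]) auto
  moreover have "\<dots> \<le> card (?P \<inter> ?Q)"
    using finP by (intro card_mono) auto
  moreover have "card ?P + card ?Q = card (?P \<union> ?Q) + card (?P \<inter> ?Q)"
    by (rule card_Un_Int[OF finP])
  ultimately show False using cJ cL by linarith
qed

text \<open>By Zorn's lemma there is a minimal set of edges that still satisfies Hall's condition, and by the
preceding lemma it offers exactly one point to each index. Local finiteness is what makes chains
harmless: over a finite set of indices a decreasing chain of edge sets is eventually constant.\<close>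

theorem hall_locally_finite:
  fixes S :: "'i \<Rightarrow> 'v set"
  assumes fin: "\<And>i. i \<in> I \<Longrightarrow> finite (S i)" and hall: "hall_condition I S"
  obtains f where "\<And>i. i \<in> I \<Longrightarrow> f i \<in> S i" "inj_on f I"
proof -
  define sub where "sub = (\<lambda>E. \<lambda>i. {v. (i :: 'i, v :: 'v) \<in> E})"
  define \<E> where "\<E> = {E. E \<subseteq> Sigma I S \<and> hall_condition I (sub E)}"
  have finsub: "finite (sub E i)" if "E \<in> \<E>" "i \<in> I" for E i
    using that by (intro finite_subset[OF _ fin[of i]]) (auto simp: \<E>_def sub_def)
  have S\<E>: "Sigma I S \<in> \<E>"
  proof -
    have "(\<Union>i\<in>J. sub (Sigma I S) i) = (\<Union>i\<in>J. S i)" if "J \<subseteq> I" for J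
      using that by (auto simp: sub_def)
    with hall show ?thesis by (simp add: \<E>_def hall_condition_def)
  qed
  have "\<exists>M\<in>\<E>. \<forall>E\<in>\<E>. E \<subseteq> M \<longrightarrow> E = M"
  proof -
    have "\<exists>M\<in>uminus ` \<E>. \<forall>X\<in>uminus ` \<E>. M \<subseteq> X \<longrightarrow> X = M"
    proof (rule subset_Zorn)
      fix C assume C: "subset.chain (uminus ` \<E>) C"
      show "\<exists>U\<in>uminus ` \<E>. \<forall>X\<in>C. X \<subseteq> U"
      proof (cases "C = {}")
        case True
        with S\<E> show ?thesis by blast
      next
        case False
        define D where "D = uminus ` C"
        have D: "D \<subseteq> \<E>" "D \<noteq> {}" and chain: "\<And>A B. A \<in> D \<Longrightarrow> B \<in> D \<Longrightarrow> A \<subseteq> B \<or> B \<subseteq> A"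
          using C False unfolding D_def subset_chain_def by (auto simp: image_iff)
        have "hall_condition I (sub (\<Inter>D))"
          unfolding hall_condition_def
        proof (intro allI impI)
          fix J assume J: "finite J" "J \<subseteq> I"
          define n where "n = (\<lambda>E. card (Sigma J (sub E)))"
          obtain E0 where E0: "E0 \<in> D" "\<And>E. E \<in> D \<Longrightarrow> n E0 \<le> n E"
            using D(2) ex_has_least_nat[of "\<lambda>E. E \<in> D" _ n] by blast
          have "Sigma J (sub E0) \<subseteq> Sigma J (sub E)" if E: "E \<in> D" for E
          proof (cases "E0 \<subseteq> E")
            case False
            with chain[OF E E0(1)] have "E \<subseteq> E0" by blast
            then have sub': "Sigma J (sub E) \<subseteq> Sigma J (sub E0)"
              by (auto simp: sub_def)
            have "finite (Sigma J (sub E0))"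
              using J E0(1) D by (intro finite_SigmaI finsub) auto
            from card_seteq[OF this sub'] E0(2)[OF E] show ?thesis by (simp add: n_def)
          qed (auto simp: sub_def)
          then have "(\<Union>i\<in>J. sub (\<Inter>D) i) = (\<Union>i\<in>J. sub E0 i)"
            using E0(1) unfolding sub_def by blast
          moreover have "card J \<le> card (\<Union>i\<in>J. sub E0 i)"
            using E0(1) D J by (intro hall_conditionD[of I]) (auto simp: \<E>_def)
          ultimately show "card J \<le> card (\<Union>i\<in>J. sub (\<Inter>D) i)" by simp
        qed
        moreover have "\<Inter>D \<subseteq> Sigma I S" using D unfolding \<E>_def by blast
        ultimately have "\<Inter>D \<in> \<E>" by (simp add: \<E>_def)
        then have "- \<Inter>D \<in> uminus ` \<E>" by blast
        moreover have "X \<subseteq> - \<Inter>D" if "X \<in> C" for X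
          using that unfolding D_def by blast
        ultimately show ?thesis by blast
      qed
    qed
    then obtain M where M: "M \<in> \<E>" and max: "\<And>X. X \<in> \<E> \<Longrightarrow> - M \<subseteq> - X \<Longrightarrow> - X = - M"
      by auto
    have "E = M" if "E \<in> \<E>" "E \<subseteq> M" for E
      using max[OF that(1)] that(2) by simp
    with M show ?thesis by blast
  qed
  then obtain M where M: "M \<in> \<E>" and Mmin: "\<And>E. E \<in> \<E> \<Longrightarrow> E \<subseteq> M \<Longrightarrow> E = M" by blast
  have hallM: "hall_condition I (sub M)" using M by (simp add: \<E>_def)
  have single: "\<exists>!v. v \<in> sub M i" if i: "i \<in> I" for i
  proof -
    have "card {i} \<le> card (\<Union>j\<in>{i}. sub M j)"
      using i by (intro hall_conditionD[OF hallM]) auto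
    then obtain v where v: "v \<in> sub M i"
      by (cases "sub M i = {}") auto
    have "\<not> hall_condition I ((sub M)(i := sub M i - {x}))" if x: "x \<in> sub M i" for x
    proof
      assume "hall_condition I ((sub M)(i := sub M i - {x}))"
      moreover have "sub (M - {(i, x)}) = (sub M)(i := sub M i - {x})"
        by (auto simp: sub_def fun_eq_iff)
      ultimately have "M - {(i, x)} \<in> \<E>" using M by (auto simp: \<E>_def)
      with Mmin[of "M - {(i, x)}"] x show False by (auto simp: sub_def)
    qed
    with hall_minimal_singleton[OF finsub[OF M] hallM i] v show ?thesis by blast
  qed
  define f where "f = (\<lambda>i. THE v. v \<in> sub M i)"
  have f: "f i \<in> sub M i" if "i \<in> I" for i
    unfolding f_def by (rule theI'[OF single[OF that]])
  have fS: "f i \<in> S i" if "i \<in> I" for i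
    using f[OF that] M by (auto simp: \<E>_def sub_def)
  have "inj_on f I"
  proof (rule inj_onI, rule ccontr)
    fix i j assume ij: "i \<in> I" "j \<in> I" "f i = f j" "i \<noteq> j"
    have "sub M i = {f i}" "sub M j = {f j}"
      using f single ij by blast+
    moreover have "card {i, j} \<le> card (\<Union>k\<in>{i, j}. sub M k)"
      using ij by (intro hall_conditionD[OF hallM]) auto
    ultimately show False using ij by simp
  qed
  with fS that show ?thesis by blast
qed

section \<open>Folner sets from an invariant mean\<close>

lemma finitely_additive_sum:
  fixes m :: "'g set \<Rightarrow> real"
  assumes add: "\<And>A B. A \<subseteq> C \<Longrightarrow> B \<subseteq> C \<Longrightarrow> A \<inter> B = {} \<Longrightarrow> m (A \<union> B) = m A + m B"
    and "finite J" "\<And>j. j \<in> J \<Longrightarrow> A j \<subseteq> C" "disjoint_family_on A J"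
  shows "m (\<Union>j\<in>J. A j) = (\<Sum>j\<in>J. m (A j))"
  using assms(2-)
proof (induction J rule: finite_induct)
  case empty
  have "m ({} \<union> {}) = m {} + m {}" by (intro add) auto
  then show ?case by simp
next
  case (insert j J)
  have "m (A j \<union> (\<Union>j\<in>J. A j)) = m (A j) + m (\<Union>j\<in>J. A j)"
    using insert by (intro add) (auto simp: disjoint_family_on_def)
  moreover have "disjoint_family_on A J"
    using insert.prems(2) by (rule disjoint_family_on_mono[rotated]) auto
  ultimately show ?case using insert by simp
qed

text \<open>Hall's theorem turns the doubling property into an injective map from two copies of the group to
the group that moves each element by left multiplication with an element of \<open>K\<close>. Cutting the two
copies into the finitely many pieces on which the multiplier is constant gives a paradoxical
decomposition, and an invariant mean would have to satisfy \<open>2 \<le> 1\<close>.\<close>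

lemma (in group) doubling_not_amenable:
  assumes K: "finite K" "K \<subseteq> carrier G"
    and doubling: "\<And>F. finite F \<Longrightarrow> F \<subseteq> carrier G \<Longrightarrow> 2 * card F \<le> card (K <#> F)"
  shows "\<not> amenable_group G"
proof
  assume "amenable_group G"
  then obtain m :: "'a set \<Rightarrow> real"
    where nonneg: "\<And>A. A \<subseteq> carrier G \<Longrightarrow> 0 \<le> m A" and one: "m (carrier G) = 1"
      and add: "\<And>A B. A \<subseteq> carrier G \<Longrightarrow> B \<subseteq> carrier G \<Longrightarrow> A \<inter> B = {} \<Longrightarrow> m (A \<union> B) = m A + m B"
      and inv: "\<And>g A. g \<in> carrier G \<Longrightarrow> A \<subseteq> carrier G \<Longrightarrow> m (l_coset G g A) = m A"
    unfolding amenable_group_def by (elim conjE exE) (use that in blast)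
  define I where "I = carrier G \<times> (UNIV :: bool set)"
  define S where "S = (\<lambda>(g, b :: bool). (\<lambda>k. k \<otimes> g) ` K)"
  have finS: "finite (S i)" for i using K by (auto simp: S_def split: prod.split)
  have hall: "hall_condition I S"
    unfolding hall_condition_def
  proof (intro allI impI)
    fix J assume J: "finite J" "J \<subseteq> I"
    let ?F = "fst ` J"
    have F: "finite ?F" "?F \<subseteq> carrier G" using J by (auto simp: I_def)
    have "J \<subseteq> ?F \<times> UNIV" by force
    then have "card J \<le> card (?F \<times> (UNIV :: bool set))"
      using F by (intro card_mono) auto
    also have "\<dots> = 2 * card ?F" by (simp add: card_cartesian_product)
    also have "\<dots> \<le> card (K <#> ?F)" by (rule doubling[OF F])
    also have "K <#> ?F = (\<Union>i\<in>J. S i)"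
      by (force simp: set_mult_def S_def split: prod.splits)
    finally show "card J \<le> card (\<Union>i\<in>J. S i)" .
  qed
  obtain f where f: "\<And>i. i \<in> I \<Longrightarrow> f i \<in> S i" and inj: "inj_on f I"
    using hall_locally_finite[OF finS hall] by metis
  define P where "P = (\<lambda>(k, b). {g \<in> carrier G. f (g, b) = k \<otimes> g})"
  have P: "P i \<subseteq> carrier G" for i by (auto simp: P_def split: prod.split)
  have img: "l_coset G (fst i) (P i) \<subseteq> carrier G" if "i \<in> K \<times> UNIV" for i
    using that K by (auto simp: l_coset_def P_def split: prod.split)
  have cancel: "k = k'" if "k \<in> K" "k' \<in> K" "g \<in> carrier G" "k \<otimes> g = k' \<otimes> g" for k k' g
    using that K by (metis right_cancel subsetD)
  have "(\<Sum>k\<in>K. m (P (k, b))) = 1" for b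
  proof -
    have "disjoint_family_on (\<lambda>k. P (k, b)) K"
      using cancel by (force simp: disjoint_family_on_def P_def)
    then have "(\<Sum>k\<in>K. m (P (k, b))) = m (\<Union>k\<in>K. P (k, b))"
      using K P by (intro finitely_additive_sum[symmetric, of "carrier G"] add) auto
    also have "(\<Union>k\<in>K. P (k, b)) = carrier G"
    proof
      show "carrier G \<subseteq> (\<Union>k\<in>K. P (k, b))"
      proof
        fix g assume g: "g \<in> carrier G"
        then have "f (g, b) \<in> S (g, b)" by (intro f) (auto simp: I_def)
        with g show "g \<in> (\<Union>k\<in>K. P (k, b))" by (auto simp: S_def P_def)
      qed
    qed (use P in blast)
    finally show ?thesis by (simp add: one)
  qed
  then have "2 = (\<Sum>k\<in>K. m (P (k, True))) + (\<Sum>k\<in>K. m (P (k, False)))" by simp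
  also have "\<dots> = (\<Sum>k\<in>K. \<Sum>b\<in>UNIV. m (P (k, b)))"
    by (simp add: sum.distrib UNIV_bool)
  also have "\<dots> = (\<Sum>i\<in>K \<times> UNIV. m (P i))"
    by (simp add: sum.cartesian_product split_def)
  also have "\<dots> = (\<Sum>i\<in>K \<times> UNIV. m (l_coset G (fst i) (P i)))"
    using K P by (intro sum.cong refl inv[symmetric]) auto
  also have "\<dots> = m (\<Union>i\<in>K \<times> UNIV. l_coset G (fst i) (P i))"
  proof (intro finitely_additive_sum[symmetric, of "carrier G"] add)
    show "disjoint_family_on (\<lambda>i. l_coset G (fst i) (P i)) (K \<times> UNIV)"
      unfolding disjoint_family_on_def
    proof (intro ballI impI)
      fix i j assume ij: "i \<in> K \<times> UNIV" "j \<in> K \<times> (UNIV :: bool set)" "i \<noteq> j"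
      show "l_coset G (fst i) (P i) \<inter> l_coset G (fst j) (P j) = {}"
      proof (rule ccontr)
        assume "l_coset G (fst i) (P i) \<inter> l_coset G (fst j) (P j) \<noteq> {}"
        then obtain g h where gh: "g \<in> carrier G" "h \<in> carrier G"
            "f (g, snd i) = fst i \<otimes> g" "f (h, snd j) = fst j \<otimes> h" "fst i \<otimes> g = fst j \<otimes> h"
          by (auto simp: l_coset_def P_def split_def)
        then have "(g, snd i) = (h, snd j)"
          using inj by (intro inj_onD[OF inj]) (auto simp: I_def)
        moreover from this have "fst i = fst j"
          using cancel[of "fst i" "fst j" g] gh ij by (simp add: mem_Times_iff)
        ultimately show False using ij by (simp add: prod_eq_iff)
      qed
    qed
  qed (use K img in auto)
  also have "\<dots> \<le> m (carrier G)"
  proof -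
    let ?U = "\<Union>i\<in>K \<times> UNIV. l_coset G (fst i) (P i)"
    have U: "?U \<subseteq> carrier G" using img by blast
    have "m (?U \<union> (carrier G - ?U)) = m ?U + m (carrier G - ?U)"
      using U by (intro add) auto
    moreover have "?U \<union> (carrier G - ?U) = carrier G" using U by blast
    ultimately show ?thesis using nonneg[of "carrier G - ?U"] by auto
  qed
  finally show False by (simp add: one)
qed

text \<open>If every finite set had a large boundary, multiplication by \<open>V = insert \<one> W\<close> would enlarge each
finite set by a fixed factor larger than one, so that multiplication by a power of \<open>V\<close> would
double it.\<close>

theorem (in group) folner_set:
  fixes \<epsilon> :: real
  assumes amen: "amenable_group G" and W: "finite W" "W \<subseteq> carrier G" and \<epsilon>: "\<epsilon> > 0"
  obtains F where "finite F" "F \<noteq> {}" "F \<subseteq> carrier G"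
    "(\<Sum>w\<in>W. real (card {f\<in>F. w \<otimes> f \<notin> F})) \<le> \<epsilon> * card F"
proof (rule ccontr)
  assume "\<not> thesis"
  with that have big: "(\<Sum>w\<in>W. real (card {f\<in>F. w \<otimes> f \<notin> F})) > \<epsilon> * card F"
    if "finite F" "F \<noteq> {}" "F \<subseteq> carrier G" for F
    using that not_less by blast
  have Wne: "W \<noteq> {}"
    using big[of "{\<one>}"] \<epsilon> by auto
  define \<delta> where "\<delta> = \<epsilon> / card W"
  have \<delta>: "\<delta> > 0" using \<epsilon> W Wne by (simp add: \<delta>_def card_gt_0_iff)
  define V where "V = insert \<one> W"
  have V: "finite V" "V \<subseteq> carrier G" using W by (auto simp: V_def)
  have finm: "finite (A <#> B)" if "finite A" "finite B" for A B
    using that by (auto simp: set_mult_def)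
  have grow: "(1 + \<delta>) * card F \<le> card (V <#> F)" if F: "finite F" "F \<subseteq> carrier G" for F
  proof (cases "F = {}")
    case False
    have "\<exists>w\<in>W. real (card {f\<in>F. w \<otimes> f \<notin> F}) > \<delta> * card F"
    proof (rule ccontr)
      assume "\<not> ?thesis"
      then have "(\<Sum>w\<in>W. real (card {f\<in>F. w \<otimes> f \<notin> F})) \<le> (\<Sum>w\<in>W. \<delta> * card F)"
        by (intro sum_mono) (auto simp: not_less)
      also have "\<dots> = \<epsilon> * card F" using W Wne by (simp add: \<delta>_def)
      finally show False using big[OF F(1) False F(2)] by simp
    qed
    then obtain w where w: "w \<in> W" "real (card {f\<in>F. w \<otimes> f \<notin> F}) > \<delta> * card F" by blast
    let ?B = "(\<lambda>f. w \<otimes> f) ` {f\<in>F. w \<otimes> f \<notin> F}"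
    have wG: "w \<in> carrier G" using w W by blast
    have "card ?B = card {f\<in>F. w \<otimes> f \<notin> F}"
      using F wG by (intro card_image inj_onI) (auto simp: subset_iff)
    moreover have "F \<union> ?B \<subseteq> V <#> F"
      using w F by (force simp: V_def set_mult_def)
    then have "card (F \<union> ?B) \<le> card (V <#> F)"
      using V F finm by (intro card_mono) auto
    moreover have "card (F \<union> ?B) = card F + card ?B"
      using F by (intro card_Un_disjoint) auto
    ultimately show ?thesis using w by (simp add: algebra_simps)
  qed simp
  define K where "K = (\<lambda>n. ((\<lambda>A. V <#> A) ^^ n) {\<one>})"
  have K: "finite (K n) \<and> K n \<subseteq> carrier G" for n
    using V by (induction n) (auto simp: K_def finm set_mult_closed[THEN subsetD])
  have grown: "(1 + \<delta>) ^ n * card F \<le> card (K n <#> F)" if F: "finite F" "F \<subseteq> carrier G" for n F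
  proof (induction n)
    case 0
    have "K 0 <#> F = F" using F by (force simp: K_def set_mult_def)
    then show ?case by simp
  next
    case (Suc n)
    have "(1 + \<delta>) ^ Suc n * card F \<le> (1 + \<delta>) * card (K n <#> F)"
      using Suc \<delta> by (simp add: mult.assoc)
    also have "\<dots> \<le> card (V <#> (K n <#> F))"
      using K F by (intro grow finm set_mult_closed) auto
    also have "V <#> (K n <#> F) = K (Suc n) <#> F"
      using V K F by (simp add: K_def set_mult_assoc)
    finally show ?case .
  qed
  obtain n where n: "2 < (1 + \<delta>) ^ n"
    using real_arch_pow[of "1 + \<delta>" 2] \<delta> by auto
  have "2 * card F \<le> card (K n <#> F)" if F: "finite F" "F \<subseteq> carrier G" for F
  proof -
    have "real (2 * card F) \<le> (1 + \<delta>) ^ n * card F"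
      using n by (simp add: mult_right_mono)
    also have "\<dots> \<le> card (K n <#> F)" by (rule grown[OF F])
    finally show ?thesis by linarith
  qed
  with doubling_not_amenable[of "K n"] K amen show False by blast
qed

section \<open>Free measure-preserving actions\<close>

locale free_pmp_action = group G for G (structure) +
  fixes M :: "'x measure" and \<alpha> :: "'a \<Rightarrow> 'x \<Rightarrow> 'x"
  assumes countable_carrier: "countable (carrier G)"
    and standard: "standard_prob_space M"
    and pmp: "pmp_action G M \<alpha>"
    and free: "essentially_free G M \<alpha>"
begin

sublocale prob_space M
  using standard by (simp add: standard_prob_space_def)

sublocale action: group_action G "space M" \<alpha>
  using pmp by (simp add: pmp_action_def)

lemma act_measurable [measurable]: "g \<in> carrier G \<Longrightarrow> \<alpha> g \<in> measurable M M"
  using pmp by (simp add: pmp_action_def)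

lemma act_distr: "g \<in> carrier G \<Longrightarrow> distr M M (\<alpha> g) = M"
  using pmp by (simp add: pmp_action_def)

lemma act_closed [simp]: "g \<in> carrier G \<Longrightarrow> x \<in> space M \<Longrightarrow> \<alpha> g x \<in> space M"
  by (rule measurable_space[OF act_measurable])

lemma act_one [simp]: "x \<in> space M \<Longrightarrow> \<alpha> \<one> x = x"
  using action.id_eq_one by (metis restrict_apply')

lemma act_mult: "g \<in> carrier G \<Longrightarrow> h \<in> carrier G \<Longrightarrow> x \<in> space M \<Longrightarrow> \<alpha> g (\<alpha> h x) = \<alpha> (g \<otimes> h) x"
  by (simp add: action.composition_rule)

lemma act_inv_act [simp]: "g \<in> carrier G \<Longrightarrow> x \<in> space M \<Longrightarrow> \<alpha> (inv g) (\<alpha> g x) = x"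
  by (simp add: act_mult)

lemma act_act_inv [simp]: "g \<in> carrier G \<Longrightarrow> x \<in> space M \<Longrightarrow> \<alpha> g (\<alpha> (inv g) x) = x"
  by (simp add: act_mult)

lemma sets_act_vimage [measurable]:
  "g \<in> carrier G \<Longrightarrow> A \<in> sets M \<Longrightarrow> {x \<in> space M. \<alpha> g x \<in> A} \<in> sets M"
  using measurable_sets[OF act_measurable, of g A] by (simp add: vimage_def Int_def conj_commute)

lemma emeasure_act_vimage:
  assumes "g \<in> carrier G" "A \<in> sets M"
  shows "emeasure M {x \<in> space M. \<alpha> g x \<in> A} = emeasure M A"
proof -
  have "emeasure M A = emeasure (distr M M (\<alpha> g)) A"
    using assms by (simp add: act_distr)
  also have "\<dots> = emeasure M (\<alpha> g -` A \<inter> space M)"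
    using assms by (intro emeasure_distr) auto
  also have "\<alpha> g -` A \<inter> space M = {x \<in> space M. \<alpha> g x \<in> A}" by auto
  finally show ?thesis ..
qed

lemma AE_act: "g \<in> carrier G \<Longrightarrow> AE x in M. P x \<Longrightarrow> AE x in M. P (\<alpha> g x)"
  by (metis AE_distrD act_measurable act_distr)

text \<open>Since the group is countable, a property that holds almost everywhere holds along almost
  every whole orbit.  This lets null sets be discarded without breaking up orbits.\<close>

lemma AE_orbit: "AE x in M. P x \<Longrightarrow> AE x in M. \<forall>g\<in>carrier G. P (\<alpha> g x)"
  using countable_carrier by (intro AE_ball_countable[THEN iffD2] ballI AE_act)

section \<open>Sections of small measure\<close>

text \<open>At a point with trivial stabiliser the finitely many points \<open>k x\<close> differ from \<open>x\<close>, hence some set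
of a countable basis contains \<open>x\<close> and none of them. The points of a basic set whose translates
leave it are the required pieces.\<close>

lemma displaced_cover:
  assumes K: "finite K" "K \<subseteq> carrier G" "\<one> \<notin> K"
  obtains Z :: "nat \<Rightarrow> 'x set"
  where "\<And>j. Z j \<in> sets M" "\<And>j k x. k \<in> K \<Longrightarrow> x \<in> Z j \<Longrightarrow> \<alpha> k x \<notin> Z j"
    "AE x in M. \<exists>j. x \<in> Z j"
proof -
  obtain T where T: "topspace T = space M" "completely_metrizable_space T" "second_countable T"
      and setsM: "sets M = sigma_sets (space M) {U. openin T U}"
    using standard by (auto simp: standard_prob_space_def)
  obtain \<B> where \<B>: "countable \<B>" "\<And>V. V \<in> \<B> \<Longrightarrow> openin T V"
      and base: "\<And>U x. openin T U \<Longrightarrow> x \<in> U \<Longrightarrow> \<exists>V\<in>\<B>. x \<in> V \<and> V \<subseteq> U"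
    using T(3) unfolding second_countable_def by metis
  have "t1_space T"
    using T(2) by (simp add: completely_metrizable_imp_metrizable_space
        metrizable_imp_Hausdorff_space Hausdorff_imp_t1_space)
  then have fin_closed: "closedin T C" if "finite C" "C \<subseteq> space M" for C
    using that T(1) by (simp add: t1_space_closedin_finite)
  define U where "U = from_nat_into (insert {} \<B>)"
  have rangeU: "range U = insert {} \<B>"
    unfolding U_def using \<B>(1) by (intro range_from_nat_into) auto
  have openU: "openin T (U j)" for j
    using rangeU \<B>(2) by (metis insert_iff openin_empty rangeI)
  have U [measurable]: "U j \<in> sets M" for j
    unfolding setsM using openU by (intro sigma_sets.Basic) auto
  define Z where "Z = (\<lambda>j. {x \<in> space M. x \<in> U j \<and> (\<forall>k\<in>K. \<alpha> k x \<notin> U j)})"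
  have "Z j \<in> sets M" for j
  proof -
    have "Z j = U j - (\<Union>k\<in>K. {x \<in> space M. \<alpha> k x \<in> U j})"
      using sets.sets_into_space[OF U] by (auto simp: Z_def)
    also have "\<dots> \<in> sets M"
      using K by (intro sets.Diff sets.finite_UN sets_act_vimage U) auto
    finally show ?thesis .
  qed
  moreover have "\<alpha> k x \<notin> Z j" if "k \<in> K" "x \<in> Z j" for j k x
    using that by (auto simp: Z_def)
  moreover have "AE x in M. \<exists>j. x \<in> Z j"
    using free unfolding essentially_free_def
  proof (rule AE_mp, intro AE_I2 impI)
    fix x assume x: "x \<in> space M" and fr: "\<forall>g\<in>carrier G. \<alpha> g x = x \<longrightarrow> g = \<one>"
    let ?C = "(\<lambda>k. \<alpha> k x) ` K"
    have "x \<notin> ?C" using fr K by force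
    moreover have "closedin T ?C"
      using K x by (intro fin_closed) auto
    then have "openin T (topspace T - ?C)" by blast
    ultimately obtain V where V: "V \<in> \<B>" "x \<in> V" "V \<subseteq> topspace T - ?C"
      using base[of "topspace T - ?C" x] x T(1) by auto
    then obtain j where "U j = V" using rangeU by (metis insertI2 rangeE)
    with V x have "x \<in> Z j" by (auto simp: Z_def)
    then show "\<exists>j. x \<in> Z j" ..
  qed
  ultimately show ?thesis by (rule that)
qed

text \<open>A maximal \<open>K\<close>-independent set, built greedily: the \<open>j\<close>-th step adds all points of \<open>Z j\<close> that are
not \<open>K\<close>-adjacent to what has been collected. Points added in the same step do not obstruct one
another because \<open>Z j\<close> is displaced by \<open>K\<close>.\<close>

lemma marker_set:
  assumes K: "finite K" "K \<subseteq> carrier G" "\<one> \<notin> K" and sym: "\<And>k. k \<in> K \<Longrightarrow> inv k \<in> K"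
  obtains A where "A \<in> sets M" "\<And>k x. k \<in> K \<Longrightarrow> x \<in> A \<Longrightarrow> \<alpha> k x \<notin> A"
    "AE x in M. x \<in> A \<or> (\<exists>k\<in>K. \<alpha> k x \<in> A)"
proof -
  obtain Z :: "nat \<Rightarrow> 'x set" where Z [measurable]: "\<And>j. Z j \<in> sets M"
    and disp: "\<And>j k x. k \<in> K \<Longrightarrow> x \<in> Z j \<Longrightarrow> \<alpha> k x \<notin> Z j"
    and cover: "AE x in M. \<exists>j. x \<in> Z j"
    using displaced_cover[OF K] by metis
  define B where "B = rec_nat {} (\<lambda>j B. B \<union> (Z j - (\<Union>k\<in>K. {x \<in> space M. \<alpha> k x \<in> B})))"
  have B0: "B 0 = {}" and BS: "B (Suc j) = B j \<union> (Z j - (\<Union>k\<in>K. {x \<in> space M. \<alpha> k x \<in> B j}))" for j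
    by (simp_all add: B_def)
  have B: "B j \<in> sets M" for j
    using K by (induction j) (auto simp: B0 BS intro!: sets.Un sets.Diff sets.finite_UN sets_act_vimage)
  have mono: "B i \<subseteq> B j" if "i \<le> j" for i j
    using that by (induction rule: dec_induct) (auto simp: BS)
  have indep: "\<alpha> k x \<notin> B j" if "k \<in> K" "x \<in> B j" for j k x
    using that
  proof (induction j arbitrary: k x)
    case (Suc j)
    have x: "x \<in> space M" using Suc.prems B[THEN sets.sets_into_space] by blast
    have kG: "k \<in> carrier G" using Suc.prems K by blast
    show ?case
    proof
      assume kx: "\<alpha> k x \<in> B (Suc j)"
      have "x \<in> B j" if "x \<notin> Z j \<or> \<alpha> k x \<in> B j"
        using Suc.prems that x by (auto simp: BS)
      moreover have "\<alpha> k x \<in> B j" if "\<alpha> k x \<notin> Z j \<or> x \<in> B j"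
        using kx that x kG sym[OF Suc.prems(1)] by (force simp: BS)
      ultimately show False
        using Suc.IH[OF Suc.prems(1), of x] disp[OF Suc.prems(1), of x j] by blast
    qed
  qed (simp add: B0)
  show ?thesis
  proof (rule that)
    show "(\<Union>j. B j) \<in> sets M" using B by blast
    show "\<alpha> k x \<notin> (\<Union>j. B j)" if k: "k \<in> K" and x: "x \<in> (\<Union>j. B j)" for k x
    proof
      assume "\<alpha> k x \<in> (\<Union>j. B j)"
      with x obtain i j where "x \<in> B i" "\<alpha> k x \<in> B j" by blast
      then have "x \<in> B (max i j)" "\<alpha> k x \<in> B (max i j)"
        using mono[of i "max i j"] mono[of j "max i j"] by auto
      with indep[OF k] show False by blast
    qed
    show "AE x in M. x \<in> (\<Union>j. B j) \<or> (\<exists>k\<in>K. \<alpha> k x \<in> (\<Union>j. B j))"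
      using cover
    proof (rule AE_mp, intro AE_I2 impI)
      fix x assume "x \<in> space M" "\<exists>j. x \<in> Z j"
      then obtain j where "x \<in> Z j" by blast
      then have "x \<in> B (Suc j) \<or> (\<exists>k\<in>K. \<alpha> k x \<in> B j)" by (auto simp: BS)
      then show "x \<in> (\<Union>j. B j) \<or> (\<exists>k\<in>K. \<alpha> k x \<in> (\<Union>j. B j))" by blast
    qed
  qed
qed

text \<open>A set that is independent for all quotients of \<open>n\<close> elements has \<open>n\<close> disjoint translates, so its
measure is at most \<open>1 / n\<close>; maximality makes it meet almost every orbit, within the bounded
distance \<open>K\<close>.\<close>

lemma small_section:
  fixes \<epsilon> :: real
  assumes \<Delta>: "subgroup \<Delta> G" "infinite \<Delta>" and \<epsilon>: "\<epsilon> > 0"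
  obtains A K where "A \<in> sets M" "emeasure M A \<le> ennreal \<epsilon>" "finite K" "K \<subseteq> \<Delta>"
    "AE x in M. \<exists>k\<in>K. \<alpha> k x \<in> A"
proof -
  interpret \<Delta>: subgroup \<Delta> G by fact
  obtain n where n: "1 / \<epsilon> < real n" using reals_Archimedean2 by blast
  obtain T where T: "T \<subseteq> \<Delta>" "finite T" "card T = n"
    using infinite_arbitrarily_large[OF \<Delta>(2)] by blast
  define K where "K = (\<lambda>(s, t). s \<otimes> inv t) ` (T \<times> T) - {\<one>}"
  have K: "finite K" "K \<subseteq> \<Delta>" "\<one> \<notin> K"
    using T by (auto simp: K_def subset_iff)
  have TG: "t \<in> carrier G" if "t \<in> T" for t using that T by auto
  have sym: "inv k \<in> K" if k: "k \<in> K" for k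
  proof -
    obtain s t where st: "s \<in> T" "t \<in> T" "k = s \<otimes> inv t" "k \<noteq> \<one>"
      using k by (auto simp: K_def)
    have inv: "inv k = t \<otimes> inv s" using st TG by (simp add: inv_mult_group)
    moreover have "inv k \<noteq> \<one>" using st TG by (metis inv_eq_1_iff inv_closed m_closed)
    ultimately show ?thesis using st by (auto simp: K_def)
  qed
  obtain A where A: "A \<in> sets M" and indep: "\<And>k x. k \<in> K \<Longrightarrow> x \<in> A \<Longrightarrow> \<alpha> k x \<notin> A"
    and cover: "AE x in M. x \<in> A \<or> (\<exists>k\<in>K. \<alpha> k x \<in> A)"
    by (rule marker_set[of K]) (use K sym \<Delta>.subset in auto)
  let ?A = "\<lambda>t. {x \<in> space M. \<alpha> t x \<in> A}"
  have "disjoint_family_on ?A T"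
    unfolding disjoint_family_on_def
  proof (intro ballI impI)
    fix s t assume st: "s \<in> T" "t \<in> T" "s \<noteq> t"
    have "s \<otimes> inv t \<noteq> \<one>"
      using st TG by (metis inv_equality inv_inv inv_closed)
    then have "s \<otimes> inv t \<in> K" using st by (auto simp: K_def)
    moreover have "\<alpha> (s \<otimes> inv t) (\<alpha> t x) = \<alpha> s x" if "x \<in> space M" for x
      using st that TG by (simp add: act_mult m_assoc)
    ultimately show "?A s \<inter> ?A t = {}" using indep by fastforce
  qed
  then have "(\<Sum>t\<in>T. emeasure M (?A t)) = emeasure M (\<Union>t\<in>T. ?A t)"
    using T TG A by (intro sum_emeasure) auto
  also have "\<dots> \<le> 1" by (rule emeasure_le_1)
  also have "(\<Sum>t\<in>T. emeasure M (?A t)) = of_nat n * emeasure M A"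
    using T TG A by (simp add: emeasure_act_vimage)
  finally have "ennreal (real n * measure M A) \<le> ennreal 1"
    by (simp add: emeasure_eq_measure ennreal_of_nat_eq_real_of_nat ennreal_mult')
  then have "real n * measure M A \<le> 1" by (simp only: ennreal_le_iff zero_le_one)
  then have "1 / \<epsilon> * measure M A \<le> 1"
    using n by (meson less_imp_le measure_nonneg mult_right_mono order_trans)
  then have "measure M A \<le> \<epsilon>" using \<epsilon> by (simp add: field_simps)
  then have small: "emeasure M A \<le> ennreal \<epsilon>"
    by (simp add: emeasure_eq_measure ennreal_leI)
  show ?thesis
  proof (rule that[of A "insert \<one> K"])
    show "AE x in M. \<exists>k\<in>insert \<one> K. \<alpha> k x \<in> A"
      using cover by (rule AE_mp) (auto intro!: AE_I2)
  qed (use A K small in auto)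
qed

section \<open>Families of restricted group elements\<close>

text \<open>The family \<open>D\<close> stands for the graphing that consists of the group elements \<open>g\<close> restricted to \<open>D g\<close>.
Indexing by the group makes unions of graphings pointwise unions of families.\<close>

definition edges :: "('a \<Rightarrow> 'x set) \<Rightarrow> ('x \<times> 'x) set" where
  "edges D = {(x, \<alpha> g x) | g x. g \<in> carrier G \<and> x \<in> space M \<and> x \<in> D g}"

definition linked :: "('a \<Rightarrow> 'x set) \<Rightarrow> ('x \<times> 'x) set" where
  "linked D = (edges D \<union> (edges D)\<inverse>)\<^sup>*"

definition total_measure :: "('a \<Rightarrow> 'x set) \<Rightarrow> ennreal" where
  "total_measure D = (\<integral>\<^sup>+g. emeasure M (D g) \<partial>count_space (carrier G))"

lemma linked_refl [simp]: "(x, x) \<in> linked D"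
  by (simp add: linked_def)

lemma linked_trans: "(x, y) \<in> linked D \<Longrightarrow> (y, z) \<in> linked D \<Longrightarrow> (x, z) \<in> linked D"
  unfolding linked_def by (rule rtrancl_trans)

lemma linked_sym: "(x, y) \<in> linked D \<Longrightarrow> (y, x) \<in> linked D"
proof -
  have "sym (linked D)" unfolding linked_def by (intro sym_rtrancl sym_Un_converse)
  then show "(x, y) \<in> linked D \<Longrightarrow> (y, x) \<in> linked D" by (rule symD)
qed

lemma linked_mono: "(\<And>g. g \<in> carrier G \<Longrightarrow> D g \<subseteq> D' g) \<Longrightarrow> linked D \<subseteq> linked D'"
  unfolding linked_def edges_def by (intro rtrancl_mono) blast

lemma linked_edge: "g \<in> carrier G \<Longrightarrow> x \<in> space M \<Longrightarrow> x \<in> D g \<Longrightarrow> (x, \<alpha> g x) \<in> linked D"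
  unfolding linked_def edges_def by (intro r_into_rtrancl) blast

lemma total_measure_UN_le:
  assumes "\<And>i g. g \<in> carrier G \<Longrightarrow> D i g \<in> sets M"
  shows "total_measure (\<lambda>g. \<Union>i. D i g) \<le> (\<Sum>i. total_measure (D (i :: nat)))"
proof -
  have "total_measure (\<lambda>g. \<Union>i. D i g) \<le> (\<integral>\<^sup>+g. (\<Sum>i. emeasure M (D i g)) \<partial>count_space (carrier G))"
    unfolding total_measure_def using assms
    by (intro nn_integral_mono emeasure_subadditive_countably) auto
  also have "\<dots> = (\<Sum>i. total_measure (D i))"
    unfolding total_measure_def by (intro nn_integral_suminf) auto
  finally show ?thesis .
qed

lemma total_measure_Un_le:
  assumes "\<And>g. g \<in> carrier G \<Longrightarrow> D g \<in> sets M" "\<And>g. g \<in> carrier G \<Longrightarrow> D' g \<in> sets M"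
  shows "total_measure (\<lambda>g. D g \<union> D' g) \<le> total_measure D + total_measure D'"
proof -
  have "total_measure (\<lambda>g. D g \<union> D' g)
      \<le> (\<integral>\<^sup>+g. emeasure M (D g) + emeasure M (D' g) \<partial>count_space (carrier G))"
    unfolding total_measure_def using assms
    by (intro nn_integral_mono emeasure_subadditive) auto
  also have "\<dots> = total_measure D + total_measure D'"
    unfolding total_measure_def by (intro nn_integral_add) auto
  finally show ?thesis .
qed

lemma total_measure_finite_support:
  assumes "finite W" "W \<subseteq> carrier G"
  shows "total_measure (\<lambda>g. if g \<in> W then B g else {}) = (\<Sum>g\<in>W. emeasure M (B g))"
proof -
  have "total_measure (\<lambda>g. if g \<in> W then B g else {})
      = (\<Sum>g\<in>W. emeasure M (if g \<in> W then B g else {}))"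
    unfolding total_measure_def using assms by (intro nn_integral_count_space') auto
  also have "\<dots> = (\<Sum>g\<in>W. emeasure M (B g))" by simp
  finally show ?thesis .
qed

section \<open>Amenable subgroups act hyperfinitely\<close>

text \<open>A change of variables: counting, over the centres \<open>x \<in> C\<close>, the visits of the translates \<open>e p x\<close> to
\<open>Y\<close> is the same as counting the points of \<open>Y\<close> by the centre to which they belong.\<close>

lemma nn_integral_visits:
  assumes "finite P" "\<And>p. p \<in> P \<Longrightarrow> e p \<in> carrier G" and Y: "Y \<in> sets M" and C: "C \<in> sets M"
  shows "(\<integral>\<^sup>+x. (\<Sum>p\<in>P. indicator Y (\<alpha> (e p) x)) * indicator C x \<partial>M)
    = (\<Sum>p\<in>P. emeasure M {y \<in> Y. \<alpha> (inv (e p)) y \<in> C})"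
proof -
  have one: "(\<integral>\<^sup>+x. indicator Y (\<alpha> g x) * indicator C x \<partial>M) = emeasure M {y \<in> Y. \<alpha> (inv g) y \<in> C}"
    if g: "g \<in> carrier G" for g
  proof -
    have YS: "Y \<subseteq> space M" and CS: "C \<subseteq> space M" using Y C sets.sets_into_space by auto
    let ?E = "{y \<in> Y. \<alpha> (inv g) y \<in> C}"
    have "?E = Y \<inter> {y \<in> space M. \<alpha> (inv g) y \<in> C}" using YS by auto
    then have E: "?E \<in> sets M" using g Y C by (auto intro!: sets.Int sets_act_vimage)
    have eq: "{x \<in> space M. \<alpha> g x \<in> ?E} = {x \<in> space M. \<alpha> g x \<in> Y} \<inter> C"
      using g CS by auto
    have "(\<integral>\<^sup>+x. indicator Y (\<alpha> g x) * indicator C x \<partial>M)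
        = (\<integral>\<^sup>+x. indicator {x \<in> space M. \<alpha> g x \<in> ?E} x \<partial>M)"
      unfolding eq by (intro nn_integral_cong) (auto simp: indicator_def)
    also have "\<dots> = emeasure M {x \<in> space M. \<alpha> g x \<in> ?E}"
      by (intro nn_integral_indicator sets_act_vimage g E)
    also have "\<dots> = emeasure M ?E" by (rule emeasure_act_vimage[OF g E])
    finally show ?thesis .
  qed
  have "(\<integral>\<^sup>+x. (\<Sum>p\<in>P. indicator Y (\<alpha> (e p) x)) * indicator C x \<partial>M)
      = (\<Sum>p\<in>P. \<integral>\<^sup>+x. indicator Y (\<alpha> (e p) x) * indicator C x \<partial>M)"
    unfolding sum_distrib_right using assms
    by (intro nn_integral_sum borel_measurable_times_ennreal borel_measurable_indicator
        measurable_compose[OF act_measurable]) auto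
  also have "\<dots> = (\<Sum>p\<in>P. emeasure M {y \<in> Y. \<alpha> (inv (e p)) y \<in> C})"
    using assms by (intro sum.cong one) auto
  finally show ?thesis .
qed

text \<open>Starting from \<open>A\<close>, clusters \<open>F x \<inter> Y n\<close> are removed one step after the other, where the centres \<open>x\<close>
range over a set \<open>C n\<close> so sparse that the clusters of one step are disjoint, and where the cluster
has few boundary points relative to what is left. In the application \<open>P\<close> lists the pairs \<open>(w, f)\<close>
for which \<open>w\<close> leads from \<open>f\<close> out of \<open>F\<close>, so \<open>\<Sum>p\<in>P. indicator (Y n) (\<alpha> (snd p) x)\<close> counts the edges that leave
the cluster.

The process exhausts \<open>A\<close>. Each set of the displaced cover is processed infinitely often, and for a
given \<open>x\<close> the finite set \<open>F x \<inter> Y n\<close> is eventually constant; so, for the remainder \<open>L\<close>, almost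
every non-empty cluster \<open>F x \<inter> L\<close> has a large boundary. Averaging over \<open>x\<close> gives clusters the
mass \<open>card F * \<mu> L\<close> and boundaries the mass \<open>card P * \<mu> L\<close>, which is at most \<open>\<epsilon> / 2\<close> times as
much. Hence \<open>\<mu> L = 0\<close>.\<close>

lemma greedy_clusters:
  fixes \<epsilon> :: real
  assumes F: "finite F" "F \<noteq> {}" "F \<subseteq> carrier G"
    and P: "finite P" "P \<subseteq> UNIV \<times> F" "real (card P) \<le> \<epsilon> / 2 * card F" and \<epsilon>: "\<epsilon> > 0"
    and A: "A \<in> sets M"
  obtains Y C :: "nat \<Rightarrow> 'x set" where
    "Y 0 = A" "\<And>n. Y (Suc n) = Y n - {y. \<exists>f\<in>F. \<alpha> (inv f) y \<in> C n}"
    "\<And>n. Y n \<in> sets M" "\<And>n. C n \<in> sets M"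
    "\<And>n f f' x. f \<in> F \<Longrightarrow> f' \<in> F \<Longrightarrow> f \<noteq> f' \<Longrightarrow> x \<in> C n \<Longrightarrow> \<alpha> (inv f \<otimes> f') x \<notin> C n"
    "\<And>n x. x \<in> C n \<Longrightarrow> (\<Sum>p\<in>P. indicator (Y n) (\<alpha> (snd p) x))
        \<le> ennreal \<epsilon> * (\<Sum>f\<in>F. indicator (Y n) (\<alpha> f x))"
    "AE x in M. \<exists>n. x \<notin> Y n"
proof -
  have FG: "f \<in> carrier G" if "f \<in> F" for f using that F by blast
  have PG: "snd p \<in> carrier G" if "p \<in> P" for p using that P FG by fastforce
  define K where "K = (\<lambda>(f, f'). inv f \<otimes> f') ` (F \<times> F) - {\<one>}"
  have "finite K" "K \<subseteq> carrier G" "\<one> \<notin> K"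
    using F FG by (auto simp: K_def)
  then obtain Z :: "nat \<Rightarrow> 'x set" where Z: "\<And>j. Z j \<in> sets M"
    and disp: "\<And>j k x. k \<in> K \<Longrightarrow> x \<in> Z j \<Longrightarrow> \<alpha> k x \<notin> Z j"
    and cover: "AE x in M. \<exists>j. x \<in> Z j"
    using displaced_cover[of K] by metis
  define b :: "'x set \<Rightarrow> 'x \<Rightarrow> ennreal" where "b = (\<lambda>Y x. \<Sum>p\<in>P. indicator Y (\<alpha> (snd p) x))"
  define c :: "'x set \<Rightarrow> 'x \<Rightarrow> ennreal" where "c = (\<lambda>Y x. \<Sum>f\<in>F. indicator Y (\<alpha> f x))"
  have b_meas: "b Y \<in> borel_measurable M" and c_meas: "c Y \<in> borel_measurable M" if "Y \<in> sets M" for Y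
    unfolding b_def c_def using that FG PG
    by (auto intro!: borel_measurable_sum borel_measurable_indicator measurable_compose[OF act_measurable])
  define good where "good = (\<lambda>Y j. {x \<in> space M. b Y x \<le> ennreal \<epsilon> * c Y x} \<inter> Z j)"
  have good: "good Y j \<in> sets M" if "Y \<in> sets M" for Y j
  proof -
    note [measurable] = b_meas[OF that] c_meas[OF that] Z
    show ?thesis unfolding good_def by measurable
  qed
  \<comment> \<open>The first component of \<open>prod_decode n\<close> takes every value infinitely often.\<close>
  define Y where "Y = rec_nat A
    (\<lambda>n Y. Y - {y. \<exists>f\<in>F. \<alpha> (inv f) y \<in> good Y (fst (prod_decode n))})"
  define C where "C = (\<lambda>n. good (Y n) (fst (prod_decode n)))"
  have Y0: "Y 0 = A" and YS: "Y (Suc n) = Y n - {y. \<exists>f\<in>F. \<alpha> (inv f) y \<in> C n}" for n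
    by (simp_all add: Y_def C_def)
  have Y: "Y n \<in> sets M" for n
  proof (induction n)
    case (Suc n)
    then have "Y (Suc n) = Y n - (\<Union>f\<in>F. {y \<in> space M. \<alpha> (inv f) y \<in> C n})"
      unfolding YS using sets.sets_into_space by blast
    also have "\<dots> \<in> sets M"
      using Suc F FG by (intro sets.Diff sets.finite_UN sets_act_vimage) (auto simp: C_def good)
    finally show ?case .
  qed (simp add: Y0 A)
  have C: "C n \<in> sets M" for n using good[OF Y] by (simp add: C_def)
  have dec: "Y n \<subseteq> Y m" if "m \<le> n" for m n
    using that by (induction rule: dec_induct) (auto simp: YS)
  have Cdisp: "\<alpha> (inv f \<otimes> f') x \<notin> C n" if "f \<in> F" "f' \<in> F" "f \<noteq> f'" "x \<in> C n" for n f f' x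
  proof -
    have "inv f \<otimes> f' \<noteq> \<one>" using that FG by (metis inv_equality inv_inv inv_closed)
    then have "inv f \<otimes> f' \<in> K" using that by (auto simp: K_def)
    with disp[of "inv f \<otimes> f'" x] that show ?thesis by (auto simp: C_def good_def)
  qed
  have Cgood: "b (Y n) x \<le> ennreal \<epsilon> * c (Y n) x" if "x \<in> C n" for n x
    using that by (auto simp: C_def good_def)
  define L where "L = (\<Inter>n. Y n)"
  have L: "L \<in> sets M" unfolding L_def using Y by blast
  have bad: "ennreal \<epsilon> * c L x \<le> b L x" if x: "x \<in> space M" "x \<in> Z j" for x j
  proof (rule ccontr)
    assume "\<not> ?thesis"
    then have lt: "b L x < ennreal \<epsilon> * c L x" by simp
    then have "c L x \<noteq> 0" by auto
    then obtain f0 where f0: "f0 \<in> F" "\<alpha> f0 x \<in> L"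
      using F by (auto simp: c_def indicator_def)
    have "\<forall>\<^sub>F n in sequentially. \<forall>f\<in>F. \<alpha> f x \<in> Y n \<longleftrightarrow> \<alpha> f x \<in> L"
    proof (intro eventually_ball_finite ballI F)
      fix f
      show "\<forall>\<^sub>F n in sequentially. \<alpha> f x \<in> Y n \<longleftrightarrow> \<alpha> f x \<in> L"
      proof (cases "\<alpha> f x \<in> L")
        case False
        then obtain m where "\<alpha> f x \<notin> Y m" by (auto simp: L_def)
        then have "\<alpha> f x \<notin> Y n" if "n \<ge> m" for n using dec[OF that] by blast
        with False show ?thesis unfolding eventually_sequentially by blast
      qed (auto simp: L_def)
    qed
    then obtain N where N: "\<And>n f. n \<ge> N \<Longrightarrow> f \<in> F \<Longrightarrow> \<alpha> f x \<in> Y n \<longleftrightarrow> \<alpha> f x \<in> L"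
      unfolding eventually_sequentially by blast
    define n where "n = prod_encode (j, N)"
    have nN: "n \<ge> N" unfolding n_def by (rule le_prod_encode_2)
    have "c (Y n) x = c L x"
      unfolding c_def using N[OF nN] by (intro sum.cong) (auto simp: indicator_def)
    moreover have "b (Y n) x = b L x"
      unfolding b_def using N[OF nN] P(2) by (intro sum.cong) (auto simp: indicator_def)
    ultimately have "x \<in> C n"
      using lt x by (simp add: C_def good_def n_def)
    moreover have "\<alpha> f0 x \<in> Y (Suc n)" using f0 by (auto simp: L_def)
    ultimately show False
      using f0 x FG by (auto simp: YS)
  qed
  have "AE x in M. ennreal \<epsilon> * (c L x * indicator (space M) x) \<le> b L x * indicator (space M) x"
    using cover by (rule AE_mp) (auto intro!: AE_I2 bad)
  then have "(\<integral>\<^sup>+x. ennreal \<epsilon> * (c L x * indicator (space M) x) \<partial>M)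
      \<le> (\<integral>\<^sup>+x. b L x * indicator (space M) x \<partial>M)"
    by (rule nn_integral_mono_AE)
  moreover have "(\<integral>\<^sup>+x. ennreal \<epsilon> * (c L x * indicator (space M) x) \<partial>M)
      = ennreal \<epsilon> * (\<integral>\<^sup>+x. c L x * indicator (space M) x \<partial>M)"
    using c_meas[OF L] by (intro nn_integral_cmult) auto
  moreover have sub: "L \<subseteq> space M" using L sets.sets_into_space by blast
  have full: "{y \<in> L. \<alpha> (inv g) y \<in> space M} = L" if "g \<in> carrier G" for g
    using that sub by auto
  have "(\<integral>\<^sup>+x. c L x * indicator (space M) x \<partial>M) = of_nat (card F) * emeasure M L"
    unfolding c_def using nn_integral_visits[of F "\<lambda>f. f" L "space M"] F(1) FG L full by simp
  moreover have "(\<integral>\<^sup>+x. b L x * indicator (space M) x \<partial>M) = of_nat (card P) * emeasure M L"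
    unfolding b_def using nn_integral_visits[of P snd L "space M"] P(1) PG L full by simp
  ultimately have "ennreal (\<epsilon> * (card F * measure M L)) \<le> ennreal (card P * measure M L)"
    using \<epsilon> by (simp add: emeasure_eq_measure ennreal_of_nat_eq_real_of_nat ennreal_mult')
  then have "\<epsilon> * (card F * measure M L) \<le> card P * measure M L"
    by (simp add: ennreal_le_iff)
  also have "\<dots> \<le> \<epsilon> / 2 * card F * measure M L"
    using P(3) by (intro mult_right_mono) auto
  finally have "\<epsilon> * card F * measure M L \<le> 0" by (simp add: algebra_simps)
  moreover have "\<epsilon> * card F > 0" using \<epsilon> F by (simp add: card_gt_0_iff)
  ultimately have "measure M L = 0"
    by (metis measure_nonneg mult_le_0_iff not_less order_antisym)
  then have "AE x in M. x \<notin> L"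
    using L by (intro AE_not_in) (simp add: null_setsI emeasure_eq_measure)
  then have "AE x in M. \<exists>n. x \<notin> Y n" by (simp add: L_def)
  with Y0 YS Y C Cdisp Cgood show ?thesis unfolding b_def c_def by (rule that)
qed

text \<open>Almost every point of \<open>A\<close> lies in one cluster and is joined to the centre of that cluster; since the
clusters are disjoint these edges cost at most \<open>\<mu> A\<close>. An edge \<open>x -- w x\<close> between different
clusters leaves the cluster that was removed first, so it is among the boundary edges of that
cluster, and all these together cost at most \<open>\<epsilon>\<close>.\<close>

theorem amenable_cheap_links:
  fixes \<epsilon> :: real
  assumes \<Lambda>: "subgroup \<Lambda> G" "amenable_group (G\<lparr>carrier := \<Lambda>\<rparr>)"
    and A: "A \<in> sets M" and W: "finite W" "W \<subseteq> \<Lambda>" and \<epsilon>: "\<epsilon> > 0"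
  obtains D where "\<And>g. D g \<in> sets M" "total_measure D \<le> emeasure M A + ennreal \<epsilon>"
    "AE x in M. \<forall>w\<in>W. x \<in> A \<longrightarrow> \<alpha> w x \<in> A \<longrightarrow> (x, \<alpha> w x) \<in> linked D"
proof -
  interpret \<Lambda>: subgroup \<Lambda> G by fact
  interpret L: group "G\<lparr>carrier := \<Lambda>\<rparr>" by (rule \<Lambda>.subgroup_is_group[OF is_group])
  \<comment> \<open>The cluster that is removed first may contain either end of the edge, so inverses are needed.\<close>
  define V where "V = W \<union> m_inv G ` W"
  have V: "finite V" "V \<subseteq> \<Lambda>" using W by (auto simp: V_def)
  have VG: "w \<in> carrier G" if "w \<in> V" for w using that V by auto
  have Vinv: "inv w \<in> V" if "w \<in> W" for w using that by (auto simp: V_def)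
  obtain F where F: "finite F" "F \<noteq> {}" "F \<subseteq> \<Lambda>"
    and folner: "(\<Sum>w\<in>V. real (card {f\<in>F. w \<otimes> f \<notin> F})) \<le> \<epsilon> / 2 * card F"
    using L.folner_set[OF \<Lambda>(2), of V "\<epsilon> / 2"] V \<epsilon> by auto
  have FG: "f \<in> carrier G" if "f \<in> F" for f using that F by auto
  define bdry where "bdry = (\<lambda>w. {f\<in>F. w \<otimes> f \<notin> F})"
  define P where "P = Sigma V bdry"
  have fin_bdry: "finite (bdry w)" "bdry w \<subseteq> F" for w using F by (auto simp: bdry_def)
  have P: "finite P" "P \<subseteq> UNIV \<times> F" "real (card P) \<le> \<epsilon> / 2 * card F"
    using V fin_bdry folner by (auto simp: P_def bdry_def)
  obtain Y C :: "nat \<Rightarrow> 'x set" where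
    Y0: "Y 0 = A" and YS: "\<And>n. Y (Suc n) = Y n - {y. \<exists>f\<in>F. \<alpha> (inv f) y \<in> C n}"
    and Y: "\<And>n. Y n \<in> sets M" and C: "\<And>n. C n \<in> sets M"
    and disp: "\<And>n f f' x. f \<in> F \<Longrightarrow> f' \<in> F \<Longrightarrow> f \<noteq> f' \<Longrightarrow> x \<in> C n \<Longrightarrow> \<alpha> (inv f \<otimes> f') x \<notin> C n"
    and bd: "\<And>n x. x \<in> C n \<Longrightarrow> (\<Sum>p\<in>P. indicator (Y n) (\<alpha> (snd p) x))
        \<le> ennreal \<epsilon> * (\<Sum>f\<in>F. indicator (Y n) (\<alpha> f x))"
    and exhaust: "AE x in M. \<exists>n. x \<notin> Y n"
    using greedy_clusters[OF F(1,2) _ P \<epsilon> A] FG by blast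
  have dec: "Y n \<subseteq> Y m" if "m \<le> n" for m n
    using that by (induction rule: dec_induct) (auto simp: YS)
  have YM: "y \<in> space M" if "y \<in> Y n" for y n using that Y sets.sets_into_space by blast
  define H where "H = (\<lambda>n f. {y \<in> Y n. \<alpha> (inv f) y \<in> C n})"
  have H: "H n f \<in> sets M" if "f \<in> F" for n f
  proof -
    have "H n f = Y n \<inter> {y \<in> space M. \<alpha> (inv f) y \<in> C n}" using YM by (auto simp: H_def)
    then show ?thesis using that FG Y C by (auto intro!: sets.Int sets_act_vimage)
  qed
  have H_removed: "y \<notin> Y m" if "y \<in> H n f" "f \<in> F" "n < m" for y n f m
    using that dec[of "Suc n" m] by (auto simp: H_def YS)
  have H_unique: "n = m \<and> f = f'" if "y \<in> H n f" "y \<in> H m f'" "f \<in> F" "f' \<in> F" for y n m f f'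
  proof -
    have yM: "y \<in> space M" using that YM by (auto simp: H_def)
    have "\<not> n < m" "\<not> m < n" using that H_removed[of y] by (auto simp: H_def)
    then have "n = m" by simp
    moreover have "f = f'"
    proof (rule ccontr)
      assume "f \<noteq> f'"
      with that \<open>n = m\<close> have "\<alpha> (inv f' \<otimes> f) (\<alpha> (inv f) y) \<notin> C n"
        by (intro disp) (auto simp: H_def)
      moreover have "\<alpha> (inv f' \<otimes> f) (\<alpha> (inv f) y) = \<alpha> (inv f') y"
        using that FG yM by (simp add: act_mult m_assoc)
      ultimately show False using that \<open>n = m\<close> by (simp add: H_def)
    qed
    ultimately show ?thesis by blast
  qed
  define U where "U = (\<lambda>f. \<Union>n. H n f)"
  have U: "U f \<in> sets M" if "f \<in> F" for f unfolding U_def using H[OF that] by blast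
  have emU: "emeasure M (U f) = (\<Sum>n. emeasure M (H n f))" if "f \<in> F" for f
    unfolding U_def using H that H_unique[of _ _ f _ f]
    by (intro suminf_emeasure[symmetric]) (auto simp: disjoint_family_on_def)
  have sumU: "(\<Sum>f\<in>F. emeasure M (U f)) \<le> emeasure M A"
  proof -
    have "disjoint_family_on U F"
      using H_unique by (fastforce simp: disjoint_family_on_def U_def)
    then have "(\<Sum>f\<in>F. emeasure M (U f)) = emeasure M (\<Union>f\<in>F. U f)"
      using F U by (intro sum_emeasure) auto
    also have "\<dots> \<le> emeasure M A"
      using A dec[of 0] by (intro emeasure_mono) (auto simp: U_def H_def Y0)
    finally show ?thesis .
  qed
  define D1 where "D1 = (\<lambda>g. if g \<in> m_inv G ` F then U (inv g) else {})"
  define D2 where "D2 = (\<lambda>g. if g \<in> V then (\<Union>f\<in>bdry g. U f) else {})"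
  define D where "D = (\<lambda>g. D1 g \<union> D2 g)"
  have D1: "D1 g \<in> sets M" and D2: "D2 g \<in> sets M" for g
    using U FG fin_bdry by (auto simp: D1_def D2_def subset_iff)
  have "total_measure D1 = (\<Sum>g\<in>m_inv G ` F. emeasure M (U (inv g)))"
    unfolding D1_def using F FG by (intro total_measure_finite_support) auto
  also have "\<dots> = (\<Sum>f\<in>F. emeasure M (U f))"
  proof -
    have "inj_on (m_inv G) F" using FG by (metis inj_onI inv_inv)
    with FG show ?thesis by (simp add: sum.reindex)
  qed
  finally have cost1: "total_measure D1 \<le> emeasure M A" using sumU by simp
  have step: "(\<Sum>p\<in>P. emeasure M (H n (snd p))) \<le> ennreal \<epsilon> * (\<Sum>f\<in>F. emeasure M (H n f))" for n
  proof -
    have PG: "snd p \<in> carrier G" if "p \<in> P" for p using that P FG by fastforce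
    have "(\<Sum>p\<in>P. emeasure M (H n (snd p)))
        = (\<integral>\<^sup>+x. (\<Sum>p\<in>P. indicator (Y n) (\<alpha> (snd p) x)) * indicator (C n) x \<partial>M)"
      unfolding H_def using nn_integral_visits[of P snd "Y n" "C n"] P(1) PG Y C by simp
    also have "\<dots> \<le> (\<integral>\<^sup>+x. ennreal \<epsilon> * ((\<Sum>f\<in>F. indicator (Y n) (\<alpha> f x)) * indicator (C n) x) \<partial>M)"
      using bd by (intro nn_integral_mono) (auto simp: indicator_def)
    also have "\<dots> = ennreal \<epsilon> * (\<integral>\<^sup>+x. (\<Sum>f\<in>F. indicator (Y n) (\<alpha> f x)) * indicator (C n) x \<partial>M)"
      using FG Y C
      by (intro nn_integral_cmult borel_measurable_times_ennreal borel_measurable_sum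
          borel_measurable_indicator measurable_compose[OF act_measurable]) auto
    also have "\<dots> = ennreal \<epsilon> * (\<Sum>f\<in>F. emeasure M (H n f))"
      unfolding H_def using nn_integral_visits[of F "\<lambda>f. f" "Y n" "C n"] F(1) FG Y C by simp
    finally show ?thesis .
  qed
  have "total_measure D2 = (\<Sum>w\<in>V. emeasure M (\<Union>f\<in>bdry w. U f))"
    unfolding D2_def using V VG by (intro total_measure_finite_support) auto
  also have "\<dots> \<le> (\<Sum>w\<in>V. \<Sum>f\<in>bdry w. emeasure M (U f))"
    using U fin_bdry by (intro sum_mono emeasure_subadditive_finite) auto
  also have "\<dots> = (\<Sum>p\<in>P. emeasure M (U (snd p)))"
    unfolding P_def using V fin_bdry by (subst sum.Sigma) (auto simp: split_def)
  also have "\<dots> = (\<Sum>p\<in>P. \<Sum>n. emeasure M (H n (snd p)))"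
    using P by (intro sum.cong refl emU) auto
  also have "\<dots> = (\<Sum>n. \<Sum>p\<in>P. emeasure M (H n (snd p)))"
    by (intro suminf_sum[symmetric]) auto
  also have "\<dots> \<le> (\<Sum>n. ennreal \<epsilon> * (\<Sum>f\<in>F. emeasure M (H n f)))"
    by (intro suminf_le step) auto
  also have "\<dots> = ennreal \<epsilon> * (\<Sum>n. \<Sum>f\<in>F. emeasure M (H n f))"
    by (rule ennreal_suminf_cmult)
  also have "(\<Sum>n. \<Sum>f\<in>F. emeasure M (H n f)) = (\<Sum>f\<in>F. \<Sum>n. emeasure M (H n f))"
    by (intro suminf_sum) auto
  also have "\<dots> = (\<Sum>f\<in>F. emeasure M (U f))"
    by (intro sum.cong refl emU[symmetric])
  also have "ennreal \<epsilon> * \<dots> \<le> ennreal \<epsilon> * 1"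
    using sumU by (intro mult_left_mono) (auto intro: order_trans[OF _ emeasure_le_1])
  finally have cost2: "total_measure D2 \<le> ennreal \<epsilon>" by simp
  have hub: "(y, \<alpha> (inv f) y) \<in> linked D" if "y \<in> H n f" "f \<in> F" for y n f
    using that FG YM by (intro linked_edge) (auto simp: D_def D1_def U_def H_def)
  have cluster: "(y, \<alpha> w y) \<in> linked D"
    if y: "y \<in> H n f" and f: "f \<in> F" and w: "w \<in> V" "\<alpha> w y \<in> Y n" for y n f w
  proof (cases "w \<otimes> f \<in> F")
    case True
    have yM: "y \<in> space M" using y YM by (auto simp: H_def)
    have "inv (w \<otimes> f) \<otimes> w = inv f"
      using f w FG VG by (simp add: inv_mult_group m_assoc)
    then have eq: "\<alpha> (inv (w \<otimes> f)) (\<alpha> w y) = \<alpha> (inv f) y"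
      using f w FG VG yM by (simp add: act_mult)
    then have "\<alpha> w y \<in> H n (w \<otimes> f)" using y w by (simp add: H_def)
    then have "(\<alpha> w y, \<alpha> (inv f) y) \<in> linked D" using hub[OF _ True] eq by metis
    with hub[OF y f] show ?thesis by (blast intro: linked_trans linked_sym)
  next
    case False
    with y f w VG YM show ?thesis
      by (intro linked_edge) (auto simp: D_def D2_def U_def bdry_def H_def)
  qed
  have removed: "\<exists>f\<in>F. y \<in> H n f" if "y \<in> Y n" "y \<notin> Y (Suc n)" for y n
    using that by (auto simp: YS H_def)
  have "AE x in M. \<forall>w\<in>W. x \<in> A \<longrightarrow> \<alpha> w x \<in> A \<longrightarrow> (x, \<alpha> w x) \<in> linked D"
    using exhaust
  proof (rule AE_mp, intro AE_I2 impI ballI)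
    fix x w assume x: "x \<in> space M" "\<exists>n. x \<notin> Y n" and w: "w \<in> W" and A: "x \<in> A" "\<alpha> w x \<in> A"
    define n where "n = (LEAST n. x \<notin> Y n \<or> \<alpha> w x \<notin> Y n)"
    have n: "x \<notin> Y n \<or> \<alpha> w x \<notin> Y n"
      unfolding n_def using x(2) by (metis (mono_tags, lifting) LeastI)
    have before: "x \<in> Y m \<and> \<alpha> w x \<in> Y m" if "m < n" for m
      using not_less_Least[OF that[unfolded n_def]] by blast
    have "n \<noteq> 0" using n A by (auto simp: Y0 intro!: Nat.gr0I)
    then obtain m where m: "n = Suc m" using not0_implies_Suc by blast
    have in_m: "x \<in> Y m" "\<alpha> w x \<in> Y m" using before m by auto
    have wV: "w \<in> V" "inv w \<in> V" using w Vinv by (auto simp: V_def)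
    show "(x, \<alpha> w x) \<in> linked D"
    proof (cases "x \<in> Y n")
      case False
      then obtain f where "f \<in> F" "x \<in> H m f" using removed in_m m by blast
      with cluster wV in_m show ?thesis by blast
    next
      case True
      then obtain f where "f \<in> F" "\<alpha> w x \<in> H m f" using removed in_m m n by blast
      moreover have "\<alpha> (inv w) (\<alpha> w x) = x" using wV VG x by simp
      ultimately have "(\<alpha> w x, x) \<in> linked D"
        using cluster[of "\<alpha> w x" m f "inv w"] wV in_m by simp
      then show ?thesis by (rule linked_sym)
    qed
  qed
  moreover have "total_measure D \<le> emeasure M A + ennreal \<epsilon>"
    unfolding D_def using D1 D2 cost1 cost2
    by (intro order_trans[OF total_measure_Un_le] add_mono) auto
  moreover have "D g \<in> sets M" for g using D1 D2 by (simp add: D_def)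
  ultimately show ?thesis by (intro that[of D])
qed

section \<open>Generating orbits cheaply\<close>

text \<open>Choose sections \<open>A n\<close> of rapidly decreasing measure with \<open>A 0\<close> the whole space, and finite sets
\<open>F n\<close> that cover \<open>\<Lambda>\<close>, where \<open>F n\<close> contains the set \<open>K (Suc n)\<close> of elements needed to move into
the next section. Once all points are linked to their translates by \<open>F n\<close>, the translates by
\<open>t \<in> F (Suc n)\<close> can be dealt with inside \<open>A (Suc n)\<close>: move \<open>x\<close> and \<open>t x\<close> into this section, and
link the two points reached there, which differ by an element of the finite set \<open>W (Suc n)\<close>. The
\<open>n\<close>-th level costs \<open>\<mu> (A n)\<close> plus an arbitrarily small amount, hence the total is barely more
than \<open>\<mu> (A 0) = 1\<close>. This treats finitely generated and locally finite \<open>\<Lambda>\<close> alike.\<close>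

theorem amenable_cheap_generation:
  fixes \<epsilon> :: real
  assumes \<Lambda>: "subgroup \<Lambda> G" "infinite \<Lambda>" "amenable_group (G\<lparr>carrier := \<Lambda>\<rparr>)" and \<epsilon>: "\<epsilon> > 0"
  obtains D where "\<And>g. D g \<in> sets M" "total_measure D \<le> 1 + ennreal \<epsilon>"
    "AE x in M. \<forall>g\<in>\<Lambda>. (x, \<alpha> g x) \<in> linked D"
proof -
  interpret \<Lambda>: subgroup \<Lambda> G by fact
  \<comment> \<open>From level one on, the amount \<open>\<delta> n\<close> is spent twice, on the section and on the boundary edges.\<close>
  define \<delta> where "\<delta> = (\<lambda>n::nat. \<epsilon> / 4 * (1 / 2) ^ n)"
  have \<delta>: "\<delta> n > 0" for n using \<epsilon> by (simp add: \<delta>_def)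
  have "\<exists>A K. A \<in> sets M \<and> emeasure M A \<le> (if n = 0 then 1 else ennreal (\<delta> n)) \<and>
      (n = 0 \<longrightarrow> K = {\<one>}) \<and> finite K \<and> K \<subseteq> \<Lambda> \<and> (AE x in M. \<exists>k\<in>K. \<alpha> k x \<in> A)" for n
  proof (cases "n = 0")
    case True
    then show ?thesis
      by (intro exI[of _ "space M"] exI[of _ "{\<one>}"]) (auto simp: emeasure_space_1)
  next
    case False
    obtain A K where "A \<in> sets M" "emeasure M A \<le> ennreal (\<delta> n)" "finite K" "K \<subseteq> \<Lambda>"
        "AE x in M. \<exists>k\<in>K. \<alpha> k x \<in> A"
      by (rule small_section[OF \<Lambda>(1,2) \<delta>[of n]])
    with False show ?thesis by (intro exI[of _ A] exI[of _ K]) simp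
  qed
  then have "\<forall>n. \<exists>p. fst p \<in> sets M \<and> emeasure M (fst p) \<le> (if n = 0 then 1 else ennreal (\<delta> n)) \<and>
      (n = 0 \<longrightarrow> snd p = {\<one>}) \<and> finite (snd p) \<and> snd p \<subseteq> \<Lambda> \<and>
      (AE x in M. \<exists>k\<in>snd p. \<alpha> k x \<in> fst p)"
    by simp
  from choice[OF this] obtain p where
    p: "\<And>n. fst (p n) \<in> sets M \<and> emeasure M (fst (p n)) \<le> (if n = 0 then 1 else ennreal (\<delta> n)) \<and>
      (n = 0 \<longrightarrow> snd (p n) = {\<one>}) \<and> finite (snd (p n)) \<and> snd (p n) \<subseteq> \<Lambda> \<and>
      (AE x in M. \<exists>k\<in>snd (p n). \<alpha> k x \<in> fst (p n))"
    by blast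
  define A where "A n = fst (p n)" for n
  define K where "K n = snd (p n)" for n
  have A: "A n \<in> sets M"
    and small: "emeasure M (A n) \<le> (if n = 0 then 1 else ennreal (\<delta> n))"
    and K: "finite (K n)" "K n \<subseteq> \<Lambda>"
    and sect: "AE x in M. \<exists>k\<in>K n. \<alpha> k x \<in> A n" for n
    using p[of n] by (simp_all add: A_def K_def)
  have K0: "K 0 = {\<one>}" using p[of 0] by (simp add: K_def)
  define F where "F = (\<lambda>n. K (Suc n) \<union> from_nat_into \<Lambda> ` {..n})"
  have ne: "\<Lambda> \<noteq> {}" using \<Lambda>.one_closed by blast
  have F: "finite (F n)" "F n \<subseteq> \<Lambda>" for n
    using K from_nat_into[OF ne] by (auto simp: F_def)
  define W where "W = (\<lambda>n. (\<lambda>(k', t, k). k' \<otimes> t \<otimes> inv k) ` (K n \<times> F n \<times> K n))"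
  have W: "finite (W n)" "W n \<subseteq> \<Lambda>" for n
  proof -
    show "finite (W n)" using K F by (auto simp: W_def)
    show "W n \<subseteq> \<Lambda>" using K[of n] F[of n] by (auto simp: W_def subset_iff)
  qed
  have "\<forall>n. \<exists>D. (\<forall>g. D g \<in> sets M) \<and> total_measure D \<le> emeasure M (A n) + ennreal (\<delta> n) \<and>
    (AE x in M. \<forall>w\<in>W n. x \<in> A n \<longrightarrow> \<alpha> w x \<in> A n \<longrightarrow> (x, \<alpha> w x) \<in> linked D)"
    by (rule allI, rule amenable_cheap_links[OF \<Lambda>(1,3) A W \<delta>]) blast
  from choice[OF this] obtain E where E: "\<And>n g. E n g \<in> sets M"
    and Ecost: "\<And>n. total_measure (E n) \<le> emeasure M (A n) + ennreal (\<delta> n)"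
    and Elink: "\<And>n. AE x in M. \<forall>w\<in>W n. x \<in> A n \<longrightarrow> \<alpha> w x \<in> A n \<longrightarrow> (x, \<alpha> w x) \<in> linked (E n)"
    by blast
  define D where "D = (\<lambda>g. \<Union>n. E n g)"
  have ED: "linked (E n) \<subseteq> linked D" for n by (intro linked_mono) (auto simp: D_def)
  have GI: "g \<in> carrier G" if "g \<in> \<Lambda>" for g using that by auto
  have level: "AE x in M. \<forall>t\<in>F n. (x, \<alpha> t x) \<in> linked D"
    if hK: "AE x in M. \<forall>k\<in>K n. (x, \<alpha> k x) \<in> linked D" for n
  proof -
    have "AE x in M. (\<exists>k\<in>K n. \<alpha> k x \<in> A n) \<and> (\<forall>k\<in>K n. (x, \<alpha> k x) \<in> linked D) \<and>
      (\<forall>w\<in>W n. x \<in> A n \<longrightarrow> \<alpha> w x \<in> A n \<longrightarrow> (x, \<alpha> w x) \<in> linked (E n))"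
      using sect[of n] hK Elink[of n] by eventually_elim blast
    from AE_orbit[OF this] show ?thesis
    proof (rule AE_mp, intro AE_I2 impI ballI)
      fix x t
      assume x: "x \<in> space M" and t: "t \<in> F n"
        and all: "\<forall>g\<in>carrier G. (\<exists>k\<in>K n. \<alpha> k (\<alpha> g x) \<in> A n) \<and>
          (\<forall>k\<in>K n. (\<alpha> g x, \<alpha> k (\<alpha> g x)) \<in> linked D) \<and>
          (\<forall>w\<in>W n. \<alpha> g x \<in> A n \<longrightarrow> \<alpha> w (\<alpha> g x) \<in> A n \<longrightarrow> (\<alpha> g x, \<alpha> w (\<alpha> g x)) \<in> linked (E n))"
      have tG: "t \<in> carrier G" using t F GI by blast
      obtain k where k: "k \<in> K n" "\<alpha> k x \<in> A n" "(x, \<alpha> k x) \<in> linked D"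
        using all[rule_format, OF one_closed] x by auto
      obtain k' where k': "k' \<in> K n" "\<alpha> k' (\<alpha> t x) \<in> A n" "(\<alpha> t x, \<alpha> k' (\<alpha> t x)) \<in> linked D"
        using all[rule_format, OF tG] by auto
      have kG: "k \<in> carrier G" "k' \<in> carrier G" using k k' K GI by blast+
      have w: "k' \<otimes> t \<otimes> inv k \<in> W n" using k k' t by (force simp: W_def)
      have "\<alpha> (k' \<otimes> t \<otimes> inv k) (\<alpha> k x) = \<alpha> k' (\<alpha> t x)"
        using kG tG x by (simp add: act_mult m_assoc)
      with all w k k' kG have "(\<alpha> k x, \<alpha> k' (\<alpha> t x)) \<in> linked D"
        using ED by (metis subsetD)
      with k k' show "(x, \<alpha> t x) \<in> linked D" by (meson linked_trans linked_sym)
    qed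
  qed
  have FD: "AE x in M. \<forall>t\<in>F n. (x, \<alpha> t x) \<in> linked D" for n
  proof (induction n)
    case 0
    show ?case by (rule level) (auto simp: K0 intro!: AE_I2)
  next
    case (Suc n)
    then have "AE x in M. \<forall>k\<in>K (Suc n). (x, \<alpha> k x) \<in> linked D"
      by (rule AE_mp) (auto simp: F_def intro!: AE_I2)
    then show ?case by (rule level)
  qed
  have "countable \<Lambda>" using countable_carrier \<Lambda>.subset by (rule countable_subset[rotated])
  then have FU: "\<exists>n. g \<in> F n" if "g \<in> \<Lambda>" for g
    using from_nat_into_surj[OF _ that] by (force simp: F_def)
  have "AE x in M. \<forall>n. \<forall>t\<in>F n. (x, \<alpha> t x) \<in> linked D"
    using FD by (simp add: AE_all_countable)
  then have link: "AE x in M. \<forall>g\<in>\<Lambda>. (x, \<alpha> g x) \<in> linked D"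
    by (rule AE_mp) (use FU in \<open>auto intro!: AE_I2\<close>)
  have sum\<delta>: "(\<lambda>n. \<delta> n) sums (\<epsilon> / 2)"
    using sums_mult[OF geometric_sums[of "1 / 2 :: real"], of "\<epsilon> / 4"] by (simp add: \<delta>_def)
  have "total_measure D \<le> (\<Sum>n. total_measure (E n))"
    unfolding D_def by (intro total_measure_UN_le E)
  also have "\<dots> \<le> (\<Sum>n. (if n = 0 then 1 else 0) + ennreal (2 * \<delta> n))"
  proof (intro suminf_le)
    fix n
    have "total_measure (E n) \<le> (if n = 0 then 1 else ennreal (\<delta> n)) + ennreal (\<delta> n)"
      by (rule order_trans[OF Ecost add_right_mono[OF small]])
    also have "\<dots> \<le> (if n = 0 then 1 else 0) + ennreal (2 * \<delta> n)"
      using \<delta>[of n] by (auto simp flip: ennreal_plus intro!: add_left_mono ennreal_leI)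
    finally show "total_measure (E n) \<le> (if n = 0 then 1 else 0) + ennreal (2 * \<delta> n)" .
  qed auto
  also have "\<dots> = (\<Sum>n. if n = 0 then 1 else 0 :: ennreal) + (\<Sum>n. ennreal (2 * \<delta> n))"
    by (intro suminf_add[symmetric]) auto
  also have "(\<Sum>n. if n = 0 then 1 else 0 :: ennreal) = 1"
    using sums_single[of 0 "\<lambda>_. 1 :: ennreal"] by (simp add: sums_iff)
  also have "(\<Sum>n. ennreal (2 * \<delta> n)) = ennreal \<epsilon>"
    using sums_mult[OF sum\<delta>, of 2] \<delta> by (intro suminf_ennreal_eq) (auto intro: less_imp_le)
  finally have "total_measure D \<le> 1 + ennreal \<epsilon>" .
  moreover have "D g \<in> sets M" for g using E by (auto simp: D_def)
  ultimately show ?thesis using link by (intro that[of D])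
qed

text \<open>This is \<open>\<Lambda> \<inter> s\<^sup>-\<^sup>1 \<Lambda> s\<close>, in the form in which its elements are used.\<close>

lemma commensurating_subgroup:
  assumes \<Lambda>: "subgroup \<Lambda> G" and s: "s \<in> carrier G"
  shows "subgroup {h \<in> \<Lambda>. s \<otimes> h \<otimes> inv s \<in> \<Lambda>} G"
proof -
  interpret \<Lambda>: subgroup \<Lambda> G by fact
  show ?thesis
  proof (rule subgroupI)
    show "{h \<in> \<Lambda>. s \<otimes> h \<otimes> inv s \<in> \<Lambda>} \<noteq> {}"
      using s by (auto intro!: exI[of _ \<one>])
  next
    fix a assume a: "a \<in> {h \<in> \<Lambda>. s \<otimes> h \<otimes> inv s \<in> \<Lambda>}"
    then have "inv (s \<otimes> a \<otimes> inv s) \<in> \<Lambda>" by blast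
    moreover have "inv (s \<otimes> a \<otimes> inv s) = s \<otimes> inv a \<otimes> inv s"
      using a s by (simp add: inv_mult_group m_assoc)
    ultimately show "inv a \<in> {h \<in> \<Lambda>. s \<otimes> h \<otimes> inv s \<in> \<Lambda>}" using a by simp
  next
    fix a b assume ab: "a \<in> {h \<in> \<Lambda>. s \<otimes> h \<otimes> inv s \<in> \<Lambda>}" "b \<in> {h \<in> \<Lambda>. s \<otimes> h \<otimes> inv s \<in> \<Lambda>}"
    then have "(s \<otimes> a \<otimes> inv s) \<otimes> (s \<otimes> b \<otimes> inv s) \<in> \<Lambda>" by blast
    moreover have "(s \<otimes> a \<otimes> inv s) \<otimes> (s \<otimes> b \<otimes> inv s) = s \<otimes> (a \<otimes> b) \<otimes> inv s"
    proof -
      have "inv s \<otimes> (s \<otimes> (b \<otimes> inv s)) = b \<otimes> inv s"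
        using ab s by (simp flip: m_assoc)
      with ab s show ?thesis by (simp add: m_assoc)
    qed
    ultimately show "a \<otimes> b \<in> {h \<in> \<Lambda>. s \<otimes> h \<otimes> inv s \<in> \<Lambda>}" using ab by simp
  qed auto
qed

text \<open>After linking the orbits of \<open>\<Lambda>\<close>, each generator \<open>s\<close> costs next to nothing: it suffices to
restrict it to a small section of the infinite group of all \<open>h \<in> \<Lambda>\<close> with \<open>s h s\<^sup>-\<^sup>1 \<in> \<Lambda>\<close>. Indeed,
some such \<open>h\<close> moves \<open>x\<close> into that section, and then \<open>s x\<close> is linked to \<open>(s h s\<^sup>-\<^sup>1) s x = s h x\<close> by
\<open>\<Lambda>\<close>, \<open>s h x\<close> to \<open>h x\<close> by the restricted generator, and \<open>h x\<close> to \<open>x\<close> by \<open>\<Lambda>\<close>.\<close>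

theorem cheap_generation:
  fixes \<epsilon> :: real
  assumes S: "finite S" "S \<subseteq> carrier G" "generate G S = carrier G"
    and \<Lambda>: "subgroup \<Lambda> G" "infinite \<Lambda>" "amenable_group (G\<lparr>carrier := \<Lambda>\<rparr>)"
    and comm: "\<And>s. s \<in> S \<Longrightarrow> infinite {h \<in> \<Lambda>. s \<otimes> h \<otimes> inv s \<in> \<Lambda>}" and \<epsilon>: "\<epsilon> > 0"
  obtains D where "\<And>g. D g \<in> sets M" "total_measure D \<le> 1 + ennreal \<epsilon>"
    "AE x in M. \<forall>g\<in>carrier G. (x, \<alpha> g x) \<in> linked D"
proof -
  interpret \<Lambda>: subgroup \<Lambda> G by fact
  obtain D1 where D1: "\<And>g. D1 g \<in> sets M" and cost1: "total_measure D1 \<le> 1 + ennreal (\<epsilon> / 2)"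
    and link1: "AE x in M. \<forall>g\<in>\<Lambda>. (x, \<alpha> g x) \<in> linked D1"
    using amenable_cheap_generation[OF \<Lambda>, of "\<epsilon> / 2"] \<epsilon> by auto
  define \<delta> where "\<delta> = \<epsilon> / 2 / (card S + 1)"
  have \<delta>: "\<delta> > 0" using \<epsilon> by (simp add: \<delta>_def)
  have "\<forall>s\<in>S. \<exists>A. A \<in> sets M \<and> emeasure M A \<le> ennreal \<delta> \<and>
      (AE x in M. \<exists>h\<in>{h \<in> \<Lambda>. s \<otimes> h \<otimes> inv s \<in> \<Lambda>}. \<alpha> h x \<in> A)"
  proof
    fix s assume s: "s \<in> S"
    have sub: "subgroup {h \<in> \<Lambda>. s \<otimes> h \<otimes> inv s \<in> \<Lambda>} G"
      using s S by (intro commensurating_subgroup \<Lambda>) auto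
    obtain A K where A: "A \<in> sets M" "emeasure M A \<le> ennreal \<delta>"
        "K \<subseteq> {h \<in> \<Lambda>. s \<otimes> h \<otimes> inv s \<in> \<Lambda>}" and K: "AE x in M. \<exists>k\<in>K. \<alpha> k x \<in> A"
      by (rule small_section[OF sub comm[OF s] \<delta>])
    from K have "AE x in M. \<exists>h\<in>{h \<in> \<Lambda>. s \<otimes> h \<otimes> inv s \<in> \<Lambda>}. \<alpha> h x \<in> A"
      by (rule AE_mp) (use A in \<open>blast intro: AE_I2\<close>)
    with A show "\<exists>A. A \<in> sets M \<and> emeasure M A \<le> ennreal \<delta> \<and>
      (AE x in M. \<exists>h\<in>{h \<in> \<Lambda>. s \<otimes> h \<otimes> inv s \<in> \<Lambda>}. \<alpha> h x \<in> A)" by blast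
  qed
  from bchoice[OF this] obtain A where A: "\<And>s. s \<in> S \<Longrightarrow> A s \<in> sets M"
      and small: "\<And>s. s \<in> S \<Longrightarrow> emeasure M (A s) \<le> ennreal \<delta>"
      and sect: "\<And>s. s \<in> S \<Longrightarrow> AE x in M. \<exists>h\<in>{h \<in> \<Lambda>. s \<otimes> h \<otimes> inv s \<in> \<Lambda>}. \<alpha> h x \<in> A s"
    by blast
  define D2 where "D2 = (\<lambda>g. if g \<in> S then A g else {})"
  have D2: "D2 g \<in> sets M" for g using A by (simp add: D2_def)
  have "total_measure D2 = (\<Sum>s\<in>S. emeasure M (A s))"
    unfolding D2_def by (rule total_measure_finite_support[OF S(1,2)])
  also have "\<dots> \<le> (\<Sum>s\<in>S. ennreal \<delta>)" by (intro sum_mono small)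
  also have "\<dots> = ennreal (card S * \<delta>)"
    using \<delta> by (simp add: ennreal_of_nat_eq_real_of_nat ennreal_mult')
  also have "\<dots> \<le> ennreal (\<epsilon> / 2)"
    using \<epsilon> by (intro ennreal_leI) (simp add: \<delta>_def field_simps)
  finally have cost2: "total_measure D2 \<le> ennreal (\<epsilon> / 2)" .
  define D where "D = (\<lambda>g. D1 g \<union> D2 g)"
  have "total_measure D \<le> 1 + ennreal (\<epsilon> / 2) + ennreal (\<epsilon> / 2)"
    unfolding D_def using D1 D2 cost1 cost2
    by (intro order_trans[OF total_measure_Un_le] add_mono) auto
  also have "\<dots> = 1 + ennreal \<epsilon>"
    using \<epsilon> by (simp add: add.assoc flip: ennreal_plus)
  finally have cost: "total_measure D \<le> 1 + ennreal \<epsilon>" .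
  have "linked D1 \<subseteq> linked D" by (intro linked_mono) (auto simp: D_def)
  then have "AE x in M. \<forall>g\<in>\<Lambda>. (x, \<alpha> g x) \<in> linked D"
    using link1 by (rule_tac AE_mp[OF link1]) (auto intro!: AE_I2)
  note link\<Lambda> = AE_orbit[OF this]
  have gen: "AE x in M. (x, \<alpha> s x) \<in> linked D" if s: "s \<in> S" for s
    using link\<Lambda> sect[OF s] AE_space
  proof eventually_elim
    case (elim x)
    have sG: "s \<in> carrier G" using s S by blast
    have x: "x \<in> space M" by (rule elim(3))
    obtain h where h: "h \<in> \<Lambda>" "s \<otimes> h \<otimes> inv s \<in> \<Lambda>" "\<alpha> h x \<in> A s" using elim(2) by blast
    have hG: "h \<in> carrier G" using h by auto
    have "(x, \<alpha> h x) \<in> linked D" using elim(1)[rule_format, OF one_closed h(1)] x by simp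
    moreover have "(\<alpha> h x, \<alpha> s (\<alpha> h x)) \<in> linked D"
      using h s sG hG x by (intro linked_edge) (auto simp: D_def D2_def)
    moreover have "(\<alpha> s x, \<alpha> (s \<otimes> h \<otimes> inv s) (\<alpha> s x)) \<in> linked D"
      using elim(1) h sG by blast
    moreover have "\<alpha> (s \<otimes> h \<otimes> inv s) (\<alpha> s x) = \<alpha> s (\<alpha> h x)"
      using sG hG x by (simp add: act_mult m_assoc)
    ultimately show ?case by (metis linked_trans linked_sym)
  qed
  have all: "AE x in M. (x, \<alpha> g x) \<in> linked D" if "g \<in> generate G S" for g
    using that
  proof induction
    case one
    show ?case by (auto intro!: AE_I2)
  next
    case (incl s)
    then show ?case by (rule gen)
  next
    case (inv s)
    have sG: "s \<in> carrier G" using inv S by blast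
    have "AE x in M. (\<alpha> (inv s) x, \<alpha> s (\<alpha> (inv s) x)) \<in> linked D"
      using AE_act[OF _ gen[OF inv], of "inv s"] sG by simp
    then show ?case
      by (rule AE_mp) (use sG in \<open>auto intro!: AE_I2 dest: linked_sym\<close>)
  next
    case (eng g h)
    have gh: "g \<in> carrier G" "h \<in> carrier G" using eng S by auto
    have "AE x in M. (\<alpha> h x, \<alpha> g (\<alpha> h x)) \<in> linked D"
      using AE_act[OF gh(2) eng.IH(1)] .
    then show ?case using eng.IH(2) AE_space
      by eventually_elim (use gh in \<open>auto simp: act_mult intro: linked_trans\<close>)
  qed
  have "AE x in M. \<forall>g\<in>carrier G. (x, \<alpha> g x) \<in> linked D"
    using all S(3) countable_carrier by (intro AE_ball_countable[THEN iffD2]) auto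
  with cost D1 D2 show ?thesis by (intro that[of D]) (auto simp: D_def)
qed

end

section \<open>Graphings and their cost\<close>

lemma nn_integral_count_space_eq_infsum:
  fixes f :: "'i \<Rightarrow> ennreal"
  assumes "countable I"
  shows "(\<integral>\<^sup>+i. f i \<partial>count_space I) = infsum f I"
proof (cases "finite I")
  case True
  then show ?thesis by (simp add: nn_integral_count_space_finite)
next
  case False
  let ?e = "from_nat_into I"
  have bij: "bij_betw ?e UNIV I" using bij_betw_from_nat_into[OF assms False] .
  have "(\<integral>\<^sup>+i. f i \<partial>count_space I) = (\<integral>\<^sup>+n. f (?e n) \<partial>count_space UNIV)"
    by (rule nn_integral_bij_count_space[OF bij, symmetric])
  also have "\<dots> = (\<Sum>n. f (?e n))" by (rule nn_integral_count_space_nat)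
  also have "\<dots> = infsum (\<lambda>n. f (?e n)) UNIV"
  proof -
    have "((\<lambda>n. f (?e n)) has_sum infsum (\<lambda>n. f (?e n)) UNIV) UNIV"
      by (intro has_sum_infsum nonneg_summable_on_complete) simp
    then show ?thesis using has_sum_imp_sums sums_unique by metis
  qed
  also have "\<dots> = infsum f I" by (rule infsum_reindex_bij_betw[OF bij])
  finally show ?thesis .
qed

context free_pmp_action
begin

lemma mp_borel_iso_act:
  assumes g: "g \<in> carrier G" and A: "A \<in> sets M"
  shows "mp_borel_iso M A {x \<in> space M. \<alpha> (inv g) x \<in> A} (\<alpha> g)"
proof -
  let ?B = "{x \<in> space M. \<alpha> (inv g) x \<in> A}"
  have AM: "x \<in> space M" if "x \<in> A" for x using that A sets.sets_into_space by blast
  have B: "?B \<in> sets M" using g A by (intro sets_act_vimage) auto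
  have bij: "bij_betw (\<alpha> g) A ?B"
    using g AM by (intro bij_betw_byWitness[where f' = "\<alpha> (inv g)"]) auto
  have meas: "\<alpha> g \<in> measurable (restrict_space M A) (restrict_space M ?B)"
    using g AM
    by (intro measurable_restrict_space2 measurable_restrict_space1 act_measurable)
      (auto simp: space_restrict_space)
  have "\<alpha> (inv g) \<in> measurable (restrict_space M ?B) (restrict_space M A)"
    using g AM
    by (intro measurable_restrict_space2 measurable_restrict_space1 act_measurable)
      (auto simp: space_restrict_space)
  moreover have "the_inv_into A (\<alpha> g) y = \<alpha> (inv g) y" if "y \<in> space (restrict_space M ?B)" for y
    using that g bij by (intro the_inv_into_f_eq) (auto simp: space_restrict_space bij_betw_def)
  ultimately have meas': "the_inv_into A (\<alpha> g) \<in> measurable (restrict_space M ?B) (restrict_space M A)"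
    by (subst measurable_cong[where g = "\<alpha> (inv g)"])
  have "distr (restrict_space M A) (restrict_space M ?B) (\<alpha> g) = restrict_space M ?B"
  proof (rule measure_eqI)
    fix X assume "X \<in> sets (distr (restrict_space M A) (restrict_space M ?B) (\<alpha> g))"
    then have X: "X \<in> sets M" "X \<subseteq> ?B" and X': "X \<in> sets (restrict_space M ?B)"
      using B by (auto simp: sets_restrict_space_iff)
    have "emeasure (distr (restrict_space M A) (restrict_space M ?B) (\<alpha> g)) X
        = emeasure (restrict_space M A) (\<alpha> g -` X \<inter> space (restrict_space M A))"
      by (rule emeasure_distr[OF meas X'])
    also have "\<alpha> g -` X \<inter> space (restrict_space M A) = {x \<in> space M. \<alpha> g x \<in> X}"
      using X g AM by (auto simp: space_restrict_space)
    also have "emeasure (restrict_space M A) \<dots> = emeasure M {x \<in> space M. \<alpha> g x \<in> X}"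
      using X A g by (intro emeasure_restrict_space) auto
    also have "\<dots> = emeasure M X" by (rule emeasure_act_vimage[OF g X(1)])
    also have "\<dots> = emeasure (restrict_space M ?B) X"
      using X B by (intro emeasure_restrict_space[symmetric]) auto
    finally show "emeasure (distr (restrict_space M A) (restrict_space M ?B) (\<alpha> g)) X
      = emeasure (restrict_space M ?B) X" .
  qed simp
  with A B bij meas meas' show ?thesis by (simp add: mp_borel_iso_def)
qed

lemma linked_orbit: "(x, y) \<in> linked D \<Longrightarrow> x \<in> space M \<Longrightarrow> \<exists>g\<in>carrier G. y = \<alpha> g x"
  unfolding linked_def
proof (induction rule: rtrancl_induct)
  case base
  then show ?case by (auto intro!: bexI[of _ \<one>])
next
  case (step y z)
  then obtain g where g: "g \<in> carrier G" "y = \<alpha> g x" by blast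
  from step(2) obtain h where h: "h \<in> carrier G" "y \<in> space M" "z \<in> space M" "z = \<alpha> h y \<or> y = \<alpha> h z"
    by (auto simp: edges_def)
  then have "z = \<alpha> h y \<or> z = \<alpha> (inv h) y" by auto
  then obtain k where "k \<in> carrier G" "z = \<alpha> k y" using h by blast
  with g step(4) show ?case
    by (auto simp: act_mult intro!: bexI[of _ "k \<otimes> g"])
qed

theorem cost_le_total_measure:
  assumes D: "\<And>g. D g \<in> sets M" and gen: "AE x in M. \<forall>g\<in>carrier G. (x, \<alpha> g x) \<in> linked D"
  shows "cost M (orbit_relation G M \<alpha>) \<le> total_measure D"
proof -
  let ?\<gamma> = "from_nat_into (carrier G)"
  define I where "I = to_nat_on (carrier G) ` carrier G"
  define A where "A = (\<lambda>i. D (?\<gamma> i))"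
  define \<phi> where "\<phi> = (\<lambda>i. \<alpha> (?\<gamma> i))"
  define B where "B = (\<lambda>i. {x \<in> space M. \<alpha> (inv (?\<gamma> i)) x \<in> A i})"
  have \<gamma>: "?\<gamma> i \<in> carrier G" for i by (rule from_nat_into) auto
  have bij: "bij_betw (to_nat_on (carrier G)) (carrier G) I"
    unfolding I_def using countable_carrier by (intro inj_on_imp_bij_betw inj_on_to_nat_on)
  have \<gamma>_to: "?\<gamma> (to_nat_on (carrier G) g) = g" if "g \<in> carrier G" for g
    using countable_carrier that by simp
  have AM: "x \<in> space M" if "x \<in> A i" for x i
    using that D[THEN sets.sets_into_space] by (auto simp: A_def)
  have "graphing M (orbit_relation G M \<alpha>) I A B \<phi>"
    unfolding graphing_def B_def \<phi>_def
    using D \<gamma> AM by (auto simp: A_def orbit_relation_def intro!: mp_borel_iso_act)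
  moreover have edges_eq: "graphing_edges I A \<phi> = edges D"
  proof
    show "graphing_edges I A \<phi> \<subseteq> edges D"
    proof
      fix e assume "e \<in> graphing_edges I A \<phi>"
      then obtain i x where "e = (x, \<alpha> (?\<gamma> i) x)" "x \<in> A i"
        by (auto simp: graphing_edges_def \<phi>_def)
      with \<gamma>[of i] AM[of x i] show "e \<in> edges D" by (auto simp: edges_def A_def)
    qed
    show "edges D \<subseteq> graphing_edges I A \<phi>"
      by (force simp: graphing_edges_def edges_def A_def \<phi>_def I_def \<gamma>_to)
  qed
  have "generates M (orbit_relation G M \<alpha>) I A \<phi>"
    unfolding generates_def graphing_component_def edges_eq linked_def[symmetric]
    using gen AE_space
  proof eventually_elim
    case (elim x)
    then have "(x, y) \<in> linked D \<longleftrightarrow> (\<exists>g\<in>carrier G. y = \<alpha> g x)" for y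
      using linked_orbit by blast
    with elim show ?case by (auto simp: orbit_relation_def)
  qed
  ultimately have "cost M (orbit_relation G M \<alpha>) \<le> graphing_cost M I A"
    unfolding cost_def by (intro Inf_lower) blast
  also have "\<dots> = infsum (\<lambda>g. emeasure M (A (to_nat_on (carrier G) g))) (carrier G)"
    unfolding graphing_cost_def by (rule infsum_reindex_bij_betw[OF bij, symmetric])
  also have "\<dots> = infsum (\<lambda>g. emeasure M (D g)) (carrier G)"
    by (intro infsum_cong) (simp add: A_def \<gamma>_to)
  also have "\<dots> = total_measure D"
    unfolding total_measure_def by (rule nn_integral_count_space_eq_infsum[OF countable_carrier, symmetric])
  finally show ?thesis .
qed

end

section \<open>The cost of an action with infinite orbits is at least one\<close>

text \<open>The next two lemmas move measurability and measure between the restricted spaces in terms of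
which a partial isomorphism is defined and the whole space.\<close>

lemma mp_borel_iso_vimage:
  assumes iso: "mp_borel_iso M A B f" and E: "E \<in> sets M"
  shows "{x \<in> A. f x \<in> E} \<in> sets M"
proof -
  have A: "A \<in> sets M" "A \<inter> space M \<in> sets M" and f: "f \<in> measurable (restrict_space M A) (restrict_space M B)"
    using iso by (auto simp: mp_borel_iso_def)
  have "E \<inter> B \<in> sets (restrict_space M B)"
    using iso E by (auto simp: mp_borel_iso_def sets_restrict_space_iff)
  from measurable_sets[OF f this] have "f -` (E \<inter> B) \<inter> space (restrict_space M A) \<in> sets M"
    using A by (auto simp: sets_restrict_space_iff)
  moreover have "f -` (E \<inter> B) \<inter> space (restrict_space M A) = {x \<in> A. f x \<in> E}"
    using iso A(1)[THEN sets.sets_into_space]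
    by (auto simp: mp_borel_iso_def space_restrict_space bij_betw_def)
  ultimately show ?thesis by simp
qed

lemma mp_borel_iso_image:
  assumes iso: "mp_borel_iso M A B f" and E: "E \<in> sets M" "E \<subseteq> A"
  shows "f ` E \<in> sets M" "emeasure M (f ` E) = emeasure M E"
proof -
  have A: "A \<in> sets M" and B: "B \<in> sets M" and bij: "bij_betw f A B"
    and f: "f \<in> measurable (restrict_space M A) (restrict_space M B)"
    and f': "the_inv_into A f \<in> measurable (restrict_space M B) (restrict_space M A)"
    and distr: "distr (restrict_space M A) (restrict_space M B) f = restrict_space M B"
    using iso by (auto simp: mp_borel_iso_def)
  have inj: "inj_on f A" and im: "f ` A = B" using bij by (auto simp: bij_betw_def)
  have sp: "space (restrict_space M A) = A" "space (restrict_space M B) = B"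
    using A B sets.sets_into_space by (auto simp: space_restrict_space)
  have "E \<in> sets (restrict_space M A)" using A E by (auto simp: sets_restrict_space_iff)
  from measurable_sets[OF f' this]
  have im_eq: "the_inv_into A f -` E \<inter> B \<in> sets (restrict_space M B)" by (simp add: sp)
  moreover have "the_inv_into A f -` E \<inter> B = f ` E"
    using inj im E(2) by (auto simp: the_inv_into_f_f image_iff subset_iff)
  ultimately have fE: "f ` E \<in> sets (restrict_space M B)" by simp
  then show fE': "f ` E \<in> sets M" using B by (auto simp: sets_restrict_space_iff)
  have "emeasure M (f ` E) = emeasure (restrict_space M B) (f ` E)"
    using B im E(2) by (intro emeasure_restrict_space[symmetric]) auto
  also have "\<dots> = emeasure (distr (restrict_space M A) (restrict_space M B) f) (f ` E)"
    by (simp add: distr)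
  also have "\<dots> = emeasure (restrict_space M A) (f -` (f ` E) \<inter> space (restrict_space M A))"
    by (rule emeasure_distr[OF f fE])
  also have "f -` (f ` E) \<inter> space (restrict_space M A) = E"
    using inj E(2) by (auto simp: sp dest: inj_onD)
  also have "emeasure (restrict_space M A) E = emeasure M E"
    using A E by (intro emeasure_restrict_space) auto
  finally show "emeasure M (f ` E) = emeasure M E" .
qed

text \<open>Let \<open>L n\<close> be the set of points at graph distance at most \<open>n\<close> from \<open>C\<close>. Every point outside \<open>C\<close>
that is connected to \<open>C\<close> has an edge along which the distance drops: either the point lies in
some \<open>Ein i\<close>, where \<open>\<phi> i\<close> decreases the distance, or it is the image under some \<open>\<phi> i\<close> of a
point of \<open>Eout i\<close>, where \<open>\<phi> i\<close> increases it. These two subsets of \<open>A i\<close> are disjoint, so the points outside \<open>C\<close> have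
total measure at most the sum of the measures of the \<open>A i\<close>.\<close>

lemma emeasure_connected_to_le:
  assumes gr: "graphing M R I A B \<phi>" and C: "C \<in> sets M"
    and meets: "AE x in M. graphing_component I A \<phi> x \<inter> C \<noteq> {}"
  shows "emeasure M (space M) \<le> emeasure M C + graphing_cost M I A"
proof -
  have iso: "mp_borel_iso M (A i) (B i) (\<phi> i)" if "i \<in> I" for i
    using gr that by (simp add: graphing_def)
  have A: "A i \<in> sets M" if "i \<in> I" for i using iso[OF that] by (simp add: mp_borel_iso_def)
  have cI: "countable I" by simp
  define L where "L = rec_nat C (\<lambda>n L. L \<union> (\<Union>i\<in>I. {x \<in> A i. \<phi> i x \<in> L}) \<union> (\<Union>i\<in>I. \<phi> i ` (A i \<inter> L)))"
  have L0: "L 0 = C" and LS: "L (Suc n) =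
      L n \<union> (\<Union>i\<in>I. {x \<in> A i. \<phi> i x \<in> L n}) \<union> (\<Union>i\<in>I. \<phi> i ` (A i \<inter> L n))" for n
    by (simp_all add: L_def)
  have L: "L n \<in> sets M" for n
  proof (induction n)
    case (Suc n)
    then show ?case unfolding LS
      by (intro sets.Un sets.countable_UN'' cI mp_borel_iso_vimage[OF iso]
          mp_borel_iso_image(1)[OF iso]) (auto intro: A)
  qed (simp add: L0 C)
  have mono: "L m \<subseteq> L n" if "m \<le> n" for m n
    using that by (induction rule: dec_induct) (auto simp: LS)
  define Ein where "Ein = (\<lambda>i. \<Union>n. {x \<in> A i. \<phi> i x \<in> L n} - L n)"
  define Eout where "Eout = (\<lambda>i. \<Union>n. (A i \<inter> L n) - {x \<in> A i. \<phi> i x \<in> L n})"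
  have Ein: "Ein i \<in> sets M" and Eout: "Eout i \<in> sets M" if "i \<in> I" for i
    unfolding Ein_def Eout_def using mp_borel_iso_vimage[OF iso[OF that] L] L A[OF that] by auto
  have sub: "Ein i \<subseteq> A i" "Eout i \<subseteq> A i" for i by (auto simp: Ein_def Eout_def)
  have disj: "Ein i \<inter> Eout i = {}" for i
  proof (rule ccontr)
    assume "Ein i \<inter> Eout i \<noteq> {}"
    then obtain x m n where "\<phi> i x \<in> L n" "x \<notin> L n" "x \<in> L m" "\<phi> i x \<notin> L m"
      by (auto simp: Ein_def Eout_def)
    moreover have "L n \<subseteq> L m \<or> L m \<subseteq> L n" using mono nat_le_linear by blast
    ultimately show False by blast
  qed
  have cover: "(\<Union>n. L n) \<subseteq> C \<union> (\<Union>i\<in>I. Ein i \<union> \<phi> i ` Eout i)"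
  proof -
    have "L n \<subseteq> C \<union> (\<Union>i\<in>I. Ein i \<union> \<phi> i ` Eout i)" for n
    proof (induction n)
      case (Suc n)
      have "L (Suc n) - L n \<subseteq> (\<Union>i\<in>I. Ein i \<union> \<phi> i ` Eout i)"
        unfolding LS Ein_def Eout_def by blast
      with Suc show ?case by blast
    qed (simp add: L0)
    then show ?thesis by blast
  qed
  have closed: "x \<in> (\<Union>n. L n)"
    if "(x, c) \<in> (graphing_edges I A \<phi> \<union> (graphing_edges I A \<phi>)\<inverse>)\<^sup>*" "c \<in> C" for x c
    using that
  proof (induction rule: converse_rtrancl_induct)
    case base
    then show ?case using L0 by blast
  next
    case (step x y)
    then obtain n where n: "y \<in> L n" by blast
    from step(1) have "x \<in> L (Suc n)"
    proof
      assume "(x, y) \<in> graphing_edges I A \<phi>"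
      then obtain i where "i \<in> I" "x \<in> A i" "y = \<phi> i x" by (auto simp: graphing_edges_def)
      with n show ?thesis unfolding LS by blast
    next
      assume "(x, y) \<in> (graphing_edges I A \<phi>)\<inverse>"
      then obtain i where "i \<in> I" "y \<in> A i" "x = \<phi> i y" by (auto simp: graphing_edges_def)
      with n show ?thesis unfolding LS by blast
    qed
    then show ?case by blast
  qed
  have "emeasure M (space M) \<le> emeasure M (\<Union>n. L n)"
    using meets by (intro emeasure_mono_AE, eventually_elim)
      (use closed L in \<open>auto simp: graphing_component_def\<close>)
  also have "\<dots> \<le> emeasure M (C \<union> (\<Union>i\<in>I. Ein i \<union> \<phi> i ` Eout i))"
    using cover C Ein mp_borel_iso_image(1)[OF iso Eout sub(2)]
    by (intro emeasure_mono sets.Un sets.countable_UN'' cI) auto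
  also have "\<dots> \<le> emeasure M C + emeasure M (\<Union>i\<in>I. Ein i \<union> \<phi> i ` Eout i)"
    using C Ein mp_borel_iso_image(1)[OF iso Eout sub(2)]
    by (intro emeasure_subadditive sets.Un sets.countable_UN'' cI) auto
  also have "emeasure M (\<Union>i\<in>I. Ein i \<union> \<phi> i ` Eout i)
      \<le> (\<Sum>i. emeasure M (if i \<in> I then Ein i \<union> \<phi> i ` Eout i else {}))"
  proof -
    have "(\<Union>i\<in>I. Ein i \<union> \<phi> i ` Eout i) = (\<Union>i. if i \<in> I then Ein i \<union> \<phi> i ` Eout i else {})"
      by (auto split: if_splits)
    then show ?thesis
      using Ein mp_borel_iso_image(1)[OF iso Eout sub(2)]
      by (simp only:) (intro emeasure_subadditive_countably, auto)
  qed
  also have "\<dots> \<le> (\<Sum>i. emeasure M (A i) * indicator I i)"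
  proof (intro suminf_le)
    fix i
    show "emeasure M (if i \<in> I then Ein i \<union> \<phi> i ` Eout i else {}) \<le> emeasure M (A i) * indicator I i"
    proof (cases "i \<in> I")
      case i: True
      have "emeasure M (Ein i \<union> \<phi> i ` Eout i) \<le> emeasure M (Ein i) + emeasure M (\<phi> i ` Eout i)"
        using Ein[OF i] mp_borel_iso_image(1)[OF iso[OF i] Eout[OF i] sub(2)]
        by (rule emeasure_subadditive)
      also have "emeasure M (\<phi> i ` Eout i) = emeasure M (Eout i)"
        by (rule mp_borel_iso_image(2)[OF iso[OF i] Eout[OF i] sub(2)])
      also have "emeasure M (Ein i) + emeasure M (Eout i) = emeasure M (Ein i \<union> Eout i)"
        using Ein[OF i] Eout[OF i] disj by (intro plus_emeasure) auto
      also have "\<dots> \<le> emeasure M (A i)"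
        using A[OF i] sub by (intro emeasure_mono) auto
      finally show ?thesis using i by simp
    qed simp
  qed auto
  also have "\<dots> = graphing_cost M I A"
    unfolding graphing_cost_def nn_integral_count_space_eq_infsum[OF cI, symmetric]
    by (simp add: nn_integral_count_space_indicator nn_integral_count_space_nat)
  finally show ?thesis by (simp add: add_left_mono)
qed

context free_pmp_action
begin

text \<open>An infinite group has sections of arbitrarily small measure, and any generating graphing connects
almost every point to such a section.\<close>

theorem cost_ge_one:
  assumes inf: "infinite (carrier G)"
  shows "1 \<le> cost M (orbit_relation G M \<alpha>)"
  unfolding cost_def
proof (rule Inf_greatest, clarify)
  fix I A B \<phi>
  assume gr: "graphing M (orbit_relation G M \<alpha>) I A B \<phi>"
    and gen: "generates M (orbit_relation G M \<alpha>) I A \<phi>"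
  show "1 \<le> graphing_cost M I A"
  proof (rule ennreal_le_epsilon)
    fix \<epsilon> :: real assume \<epsilon>: "\<epsilon> > 0"
    obtain C K where C: "C \<in> sets M" "emeasure M C \<le> ennreal \<epsilon>" and K: "K \<subseteq> carrier G"
      and sect: "AE x in M. \<exists>k\<in>K. \<alpha> k x \<in> C"
      by (rule small_section[OF subgroup_self inf \<epsilon>])
    have "AE x in M. graphing_component I A \<phi> x \<inter> C \<noteq> {}"
      using gen[unfolded generates_def] sect AE_space
    proof eventually_elim
      case (elim x)
      then obtain k where "k \<in> K" "\<alpha> k x \<in> C" by blast
      with K elim have "\<alpha> k x \<in> orbit_relation G M \<alpha> `` {x} \<inter> C"
        by (auto simp: orbit_relation_def)
      with elim show ?case by auto
    qed
    from emeasure_connected_to_le[OF gr C(1) this]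
    have "1 \<le> emeasure M C + graphing_cost M I A" by (simp add: emeasure_space_1)
    also have "\<dots> \<le> ennreal \<epsilon> + graphing_cost M I A" using C(2) by (rule add_right_mono)
    finally show "1 \<le> graphing_cost M I A + ennreal \<epsilon>" by (simp add: add.commute)
  qed
qed

end

section \<open>Fixed price one\<close>

lemma (in group) countable_generate:
  assumes "finite S" "S \<subseteq> carrier G"
  shows "countable (generate G S)"
proof -
  define E where "E = S \<union> m_inv G ` S"
  have E: "E \<subseteq> carrier G" using assms by (auto simp: E_def)
  let ?prod = "\<lambda>xs. foldr (\<otimes>) xs \<one>"
  have closed: "set xs \<subseteq> E \<Longrightarrow> ?prod xs \<in> carrier G" for xs
    using E by (induction xs) auto
  have append: "set xs \<subseteq> E \<Longrightarrow> set ys \<subseteq> E \<Longrightarrow> ?prod xs \<otimes> ?prod ys = ?prod (xs @ ys)" for xs ys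
  proof (induction xs)
    case Nil
    then show ?case using closed[of ys] by simp
  next
    case (Cons x xs)
    then show ?case using closed[of xs] closed[of ys] E by (auto simp: m_assoc)
  qed
  have "g \<in> ?prod ` lists E" if "g \<in> generate G S" for g
    using that
  proof induction
    case one
    show ?case by (rule image_eqI[of _ _ "[]"]) auto
  next
    case (incl s)
    then show ?case using assms by (intro image_eqI[of _ _ "[s]"]) (auto simp: E_def)
  next
    case (inv s)
    then show ?case using assms by (intro image_eqI[of _ _ "[inv s]"]) (auto simp: E_def)
  next
    case (eng g h)
    then obtain xs ys where "xs \<in> lists E" "g = ?prod xs" "ys \<in> lists E" "h = ?prod ys" by blast
    then show ?case using append[of xs ys] by (intro image_eqI[of _ _ "xs @ ys"]) (auto simp: in_lists_conv_set)
  qed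
  moreover have "countable (?prod ` lists E)"
    using assms by (intro countable_image countable_lists countable_finite) (simp add: E_def)
  ultimately show ?thesis by (meson countable_subset subsetI)
qed

theorem corollary1p2:
  fixes G :: "('g, 'm) monoid_scheme" (structure)
    and S \<Lambda> :: "'g set"
  assumes "group G"
    and "S \<subseteq> carrier G" and "finite S" and "set_inv S = S" and "\<one> \<in> S"
    and "generate G S = carrier G"
    and "subgroup \<Lambda> G" and "infinite \<Lambda>" and "amenable_group (G\<lparr>carrier := \<Lambda>\<rparr>)"
    and "\<And>s. s \<in> S \<Longrightarrow> infinite (\<Lambda> \<inter> ((inv s <# \<Lambda>) #> s))"
  shows "fixed_price_one TYPE('x) G"
  unfolding fixed_price_one_def
proof (intro allI impI)
  fix M :: "'x measure" and \<alpha>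
  assume std: "standard_prob_space M" and pmp: "pmp_action G M \<alpha>" and free: "essentially_free G M \<alpha>"
  interpret group G by fact
  interpret \<Lambda>: subgroup \<Lambda> G by fact
  interpret free_pmp_action G M \<alpha>
    using std pmp free countable_generate[OF assms(3,2)] assms(6)
    by unfold_locales auto
  have comm: "infinite {h \<in> \<Lambda>. s \<otimes> h \<otimes> inv s \<in> \<Lambda>}" if s: "s \<in> S" for s
  proof -
    have sG: "s \<in> carrier G" using s assms(2) by blast
    have "\<Lambda> \<inter> ((inv s <# \<Lambda>) #> s) \<subseteq> {h \<in> \<Lambda>. s \<otimes> h \<otimes> inv s \<in> \<Lambda>}"
    proof
      fix h assume "h \<in> \<Lambda> \<inter> ((inv s <# \<Lambda>) #> s)"
      then obtain l where l: "l \<in> \<Lambda>" "h = inv s \<otimes> l \<otimes> s" and h: "h \<in> \<Lambda>"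
        by (auto simp: l_coset_def r_coset_def)
      have lG: "l \<in> carrier G" using l by auto
      have "s \<otimes> h = l \<otimes> s" using sG lG l(2) by (simp add: m_assoc[symmetric])
      then have "s \<otimes> h \<otimes> inv s = l" using sG lG by (simp add: m_assoc)
      then show "h \<in> {h \<in> \<Lambda>. s \<otimes> h \<otimes> inv s \<in> \<Lambda>}" using l h by simp
    qed
    with assms(10)[OF s] show ?thesis using finite_subset by blast
  qed
  have "cost M (orbit_relation G M \<alpha>) \<le> 1"
  proof (rule ennreal_le_epsilon)
    fix \<epsilon> :: real assume \<epsilon>: "\<epsilon> > 0"
    obtain D where "\<And>g. D g \<in> sets M" "total_measure D \<le> 1 + ennreal \<epsilon>"
        "AE x in M. \<forall>g\<in>carrier G. (x, \<alpha> g x) \<in> linked D"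
      by (rule cheap_generation[OF assms(3,2,6,7,8,9) comm \<epsilon>]) blast+
    then show "cost M (orbit_relation G M \<alpha>) \<le> 1 + ennreal \<epsilon>"
      using cost_le_total_measure order_trans by blast
  qed
  moreover have "infinite (carrier G)"
    using assms(8) \<Lambda>.subset finite_subset by blast
  then have "1 \<le> cost M (orbit_relation G M \<alpha>)" by (rule cost_ge_one)
  ultimately show "cost M (orbit_relation G M \<alpha>) = 1" by (rule antisym)
qed

end
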